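(* There are absolute constants $C,c>0$ such that the following holds. Let $\alpha>0$ and $0\le\varepsilon\le0.1$ satisfy $\varepsilon^\alpha\le\min\{0.0106,\ \frac{1.8}{\ln(10/\varepsilon^{1+\alpha})}\}$, and let $G=(V,E)$, $V=[n]$, be any graph with $m\ge C/\varepsilon^2$ edges. Then the output $S$ of the following algorithm satisfies $\mathbb E[\mathrm{val}_G(S)]\ge(\frac12+c\,\varepsilon^{1+\alpha})\mathrm{OPT}_G$. Algorithm: (1) set $d=24/\varepsilon^{1+\alpha}$; for each $v$ let $\hat d(v)=d(v)+\mathrm{Lap}(12/\varepsilon)$ (independent) and $V_1=\{v:\hat d(v)>d\}$. (2) Let $G_1=(V_1,E_1)$ with $E_1$ the edges with both endpoints in $V_1$; sample $S_1^A\in\{\pm1\}^{V_1}$ with $\Pr[S_1^A=\hat S]\propto\exp(\varepsilon\,\mathrm{val}_{G_1}(\hat S)/12)$. (3) Let $V_2=V\setminus V_1$ and $\widetilde E$ the edges with both endpoints in $V_2$; form $E_2$ by keeping each edge of $\widetilde E$ independently with probability $\varepsilon^{1+\alpha}/70$; let $G_2=(V_2,E_2)$; each $v\in V_2$ picks a uniformly random neighbor $f(v)$ in $G_2$ ($f(v)=\bot$ if isolated); let $E_M=\{\{u,v\}\in E_2: f(u)=v,f(v)=u\}$ and $G_M=(V_2,E_M)$. (4) Sample $S_2^A\in\{\pm1\}^{V_2}$ with $\Pr[S_2^A=\hat S]\propto\exp(2.5\,\mathrm{val}_{G_M}(\hat S)/4)$. (5) Let $S_1^B$ be uniform in $\{\pm1\}^{V_2}$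 and $S_2^B$ uniform in $\{\pm1\}^{V_1}$; $S_1$ is the concatenation of $S_1^A,S_1^B$, $S_2$ the concatenation of $S_2^A,S_2^B$, and $S_3$ is the cut $(V_1,V_2)$. (6) Output one of $S_1,S_2,S_3$ chosen by the exponential mechanism with privacy budget $\varepsilon/2$ and score $\mathrm{val}_G$ (sensitivity $1$), i.e. $S_i$ is chosen with probability proportional to $\exp(\varepsilon\,\mathrm{val}_G(S_i)/4)$.
   Context: $G$ is a simple undirected graph with degrees $d(v)$. A cut is an assignment in $\{\pm1\}^V$ (the cut $(V_1,V_2)$ assigns $+1$ to $V_1$ and $-1$ to $V_2$); $\mathrm{val}_H(S)$ is the number of edges of $H$ whose endpoints receive different values, and $\mathrm{OPT}_G$ is the maximum cut size of $G$. $\mathrm{Lap}(b)$ has density $\frac1{2b}e^{-|x|/b}$. *)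

theory Defs
  imports "HOL-Probability.Probability"
begin

definition simple_graph :: "nat \<Rightarrow> nat set set \<Rightarrow> bool" where
  "simple_graph n E \<longleftrightarrow> E \<subseteq> {e. \<exists>u v. u \<noteq> v \<and> u < n \<and> v < n \<and> e = {u, v}}"

definition degree :: "nat set set \<Rightarrow> nat \<Rightarrow> nat" where
  "degree E v = card {e \<in> E. v \<in> e}"

definition cuts :: "nat set \<Rightarrow> (nat \<Rightarrow> int) set" where
  "cuts W = W \<rightarrow>\<^sub>E {-1, 1}"

definition val :: "nat set set \<Rightarrow> (nat \<Rightarrow> int) \<Rightarrow> nat" where
  "val H S = card {e \<in> H. \<exists>u v. e = {u, v} \<and> S u \<noteq> S v}"

definition OPT :: "nat \<Rightarrow> nat set set \<Rightarrow> nat" where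
  "OPT n E = Max (val E ` cuts {..<n})"

definition laplace_density :: "real \<Rightarrow> real \<Rightarrow> real" where
  "laplace_density b x = exp (- \<bar>x\<bar> / b) / (2 * b)"

definition laplace :: "real \<Rightarrow> real measure" where
  "laplace b = density lborel (\<lambda>x. ennreal (laplace_density b x))"

definition expmech :: "'a set \<Rightarrow> ('a \<Rightarrow> real) \<Rightarrow> 'a pmf" where
  "expmech A q = embed_pmf (\<lambda>x. if x \<in> A then exp (q x) / (\<Sum>y\<in>A. exp (q y)) else 0)"

definition V1_of :: "real \<Rightarrow> real \<Rightarrow> nat \<Rightarrow> nat set set \<Rightarrow> (nat \<Rightarrow> real) \<Rightarrow> nat set" where
  "V1_of \<epsilon> \<alpha> n E x = {v \<in> {..<n}. real (degree E v) + x v > 24 / \<epsilon> powr (1 + \<alpha>)}"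

definition alg_given_V1 ::
  "real \<Rightarrow> real \<Rightarrow> nat \<Rightarrow> nat set set \<Rightarrow> nat set \<Rightarrow> (nat \<Rightarrow> int) pmf" where
  "alg_given_V1 \<epsilon> \<alpha> n E V1 =
    (let V2 = {..<n} - V1;
         E1 = {e \<in> E. e \<subseteq> V1};
         Et = {e \<in> E. e \<subseteq> V2}
     in do {
       S1A \<leftarrow> expmech (cuts V1) (\<lambda>S. \<epsilon> * real (val E1 S) / 12);
       E2 \<leftarrow> map_pmf (\<lambda>b. {e \<in> Et. b e})
               (Pi_pmf Et False (\<lambda>_. bernoulli_pmf (\<epsilon> powr (1 + \<alpha>) / 70)));
       f \<leftarrow> Pi_pmf V2 None (\<lambda>v. if {u. {u, v} \<in> E2} = {} then return_pmf None
                                 else map_pmf Some (pmf_of_set {u. {u, v} \<in> E2}));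
       S2A \<leftarrow> expmech (cuts V2)
               (\<lambda>S. 2.5 * real (val {e \<in> E2. \<exists>u v. e = {u, v} \<and> f u = Some v \<and> f v = Some u} S) / 4);
       S1B \<leftarrow> pmf_of_set (cuts V2);
       S2B \<leftarrow> pmf_of_set (cuts V1);
       i \<leftarrow> expmech {0, 1, 2 :: nat}
             (\<lambda>i. \<epsilon> * real (val E ([\<lambda>v. if v \<in> V1 then S1A v else S1B v,
                                       \<lambda>v. if v \<in> V2 then S2A v else S2B v,
                                       \<lambda>v. if v \<in> V1 then 1 else -1] ! i)) / 4);
       return_pmf ([\<lambda>v. if v \<in> V1 then S1A v else S1B v,
                    \<lambda>v. if v \<in> V2 then S2A v else S2B v,
                    \<lambda>v. if v \<in> V1 then 1 else -1] ! i)
     })"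

definition alg :: "real \<Rightarrow> real \<Rightarrow> nat \<Rightarrow> nat set set \<Rightarrow> (nat \<Rightarrow> int) measure" where
  "alg \<epsilon> \<alpha> n E =
     PiM {..<n} (\<lambda>_. laplace (12 / \<epsilon>)) \<bind>
       (\<lambda>x. measure_pmf (alg_given_V1 \<epsilon> \<alpha> n E (V1_of \<epsilon> \<alpha> n E x)))"

end

theory Submission
  imports Defs
begin

text \<open>Condition on \<open>V1\<close>, write \<open>m\<close> for the number of edges and \<open>p = \<epsilon> powr (1 + \<alpha>)\<close>. By Gibbs' inequality the
  exponential mechanism loses at most \<open>8 / \<epsilon>\<close> against the best of its three candidates. If
  \<open>OPT < 0.9 m\<close>, this is all that is needed. Otherwise, if many edges cross, \<open>S3\<close> gains a constant
  fraction of \<open>m\<close>; if many edges lie inside \<open>V1\<close>, so does \<open>S1\<close>, provided few vertices of \<open>V1\<close> have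
  small degree; and if many edges lie inside \<open>V2\<close>, the random matching makes the mean of \<open>S2\<close> exceed
  \<open>m / 2\<close> by order \<open>p m\<close>. In the last case the loss \<open>8 / \<epsilon>\<close> may exceed this gain. It is
  compensated by the maximum of the two random values \<open>val S1\<close> and \<open>val S2\<close>, whose difference is of order
  \<open>sqrt m\<close> (a fourth-moment bound for quadratic forms in random signs), which dominates
  \<open>1 / \<epsilon>\<close> since \<open>m \<ge> C / \<epsilon>\<^sup>2\<close>. The exceptional configurations have small expected size by the
  tails of the Laplace noise, and enter the conditional bound linearly.\<close>

text \<open>Write \<open>q = \<epsilon> powr \<alpha>\<close>, so \<open>p = \<epsilon> * q\<close>,
  and let \<open>N\<close> count the non-isolated vertices of \<open>V1\<close>. For
  \<open>m\<close> of order \<open>1 / \<epsilon>\<^sup>2\<close> the matching gain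
  \<open>p * m\<close> is of order \<open>q / \<epsilon>\<close>. Since \<open>q\<close> has no
  positive lower bound, no choice of \<open>C\<close> lifts it above the selection loss
  \<open>8 / \<epsilon>\<close>; a fluctuation of order \<open>sqrt m\<close> carries no factor
  \<open>q\<close> and does exceed that loss. The second obstacle is the loss
  \<open>12 / \<epsilon> * N\<close> of \<open>S1\<close>: the mean of \<open>N\<close> is only
  bounded by \<open>p * m / 10\<close>, which allows a loss of \<open>1.2 * q * m\<close>, far above
  the gain. So it is never subtracted directly. While it stays below \<open>m / 20\<close>, the
  constant-fraction gain of \<open>S1\<close> absorbs it; otherwise only the intended gain and
  \<open>8 / \<epsilon>\<close> are written off, in proportion to \<open>N\<close>, and the mean of
  this charge is a small part of the gain. The logarithmic hypothesis keeps vertices of low degree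
  out of \<open>V1\<close>: the threshold \<open>24 / p\<close> is \<open>2 / q\<close> noise scales
  \<open>12 / \<epsilon>\<close>, and nine tenths of it, \<open>1.8 / q\<close> scales, remain for
  degrees up to \<open>2.4 / p\<close>.\<close>

abbreviation expec :: "'a pmf \<Rightarrow> ('a \<Rightarrow> real) \<Rightarrow> real" where
  "expec \<equiv> measure_pmf.expectation"

section \<open>The exponential mechanism\<close>

lemma expec_bind:
  assumes "finite (set_pmf p)" and "\<And>x. x \<in> set_pmf p \<Longrightarrow> finite (set_pmf (f x))"
  shows "expec (p \<bind> f) h = expec p (\<lambda>x. expec (f x) h)"
  by (simp add: pmf_expectation_bind[OF assms order_refl]
      integral_measure_pmf[OF assms(1)] assms)

lemma expec_mono:
  assumes "finite (set_pmf p)" and "\<And>x. x \<in> set_pmf p \<Longrightarrow> f x \<le> g x"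
  shows "expec p f \<le> expec p g"
  using assms by (intro integral_mono_AE integrable_measure_pmf_finite) (auto simp: AE_measure_pmf_iff)

lemma expec_cong:
  assumes "\<And>x. x \<in> set_pmf p \<Longrightarrow> f x = g x"
  shows "expec p f = expec p g"
  using assms by (intro integral_cong_AE) (auto simp: AE_measure_pmf_iff)

lemma expec_ge_const:
  assumes "finite (set_pmf p)" and "\<And>x. x \<in> set_pmf p \<Longrightarrow> c \<le> f x"
  shows "c \<le> expec p f"
  using expec_mono[of p "\<lambda>_. c" f] assms by simp

lemma expec_diff:
  assumes "finite (set_pmf p)"
  shows "expec p (\<lambda>x. f x - g x) = expec p f - expec p g"
  using assms by (intro Bochner_Integration.integral_diff integrable_measure_pmf_finite)

lemma expec_add:
  assumes "finite (set_pmf p)"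
  shows "expec p (\<lambda>x. f x + g x) = expec p f + expec p g"
  using assms by (intro Bochner_Integration.integral_add integrable_measure_pmf_finite)

lemma expec_sum:
  assumes "finite (set_pmf p)"
  shows "expec p (\<lambda>x. \<Sum>i\<in>I. f i x) = (\<Sum>i\<in>I. expec p (f i))"
  using assms by (intro Bochner_Integration.integral_sum integrable_measure_pmf_finite)

lemma pmf_expmech:
  assumes "finite A" "A \<noteq> {}"
  shows "pmf (expmech A q) x = (if x \<in> A then exp (q x) / (\<Sum>y\<in>A. exp (q y)) else 0)"
  unfolding expmech_def
proof (rule pmf_embed_pmf)
  let ?Z = "\<Sum>y\<in>A. exp (q y)"
  have Z: "?Z > 0" using assms by (simp add: sum_pos)
  show "0 \<le> (if x \<in> A then exp (q x) / ?Z else 0)" for x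
    using Z by simp
  have "(\<integral>\<^sup>+ x. ennreal (if x \<in> A then exp (q x) / ?Z else 0) \<partial>count_space UNIV)
      = (\<Sum>x\<in>A. ennreal (if x \<in> A then exp (q x) / ?Z else 0))"
    using assms by (intro nn_integral_count_space') auto
  also have "\<dots> = ennreal (\<Sum>x\<in>A. exp (q x) / ?Z)"
    using Z by (subst sum_ennreal[symmetric]) auto
  also have "\<dots> = 1" using Z by (simp flip: sum_divide_distrib)
  finally show "(\<integral>\<^sup>+ x. ennreal (if x \<in> A then exp (q x) / ?Z else 0) \<partial>count_space UNIV) = 1" .
qed

lemma set_expmech:
  assumes "finite A" "A \<noteq> {}"
  shows "set_pmf (expmech A q) = A"
proof -
  have "(\<Sum>y\<in>A. exp (q y)) > 0" using assms by (simp add: sum_pos)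
  then show ?thesis by (auto simp: set_pmf_iff pmf_expmech[OF assms] split: if_splits)
qed

lemma expec_expmech:
  assumes "finite A" "A \<noteq> {}"
  shows "expec (expmech A q) g = (\<Sum>x\<in>A. exp (q x) * g x) / (\<Sum>y\<in>A. exp (q y))"
  by (subst integral_measure_pmf[OF assms(1)])
     (auto simp: set_expmech pmf_expmech assms sum_divide_distrib)

text \<open>Gibbs' inequality; it follows termwise from \<open>t * exp t \<ge> exp t - 1\<close>.\<close>

lemma expec_expmech_ge_ln_mean:
  assumes "finite A" "A \<noteq> {}"
  shows "ln ((\<Sum>x\<in>A. exp (q x)) / card A) \<le> expec (expmech A q) q"
proof -
  let ?Z = "\<Sum>x\<in>A. exp (q x)"
  define y where "y = ln (?Z / card A)"
  have Z: "?Z > 0" using assms by (simp add: sum_pos)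
  have c: "real (card A) > 0" using assms by (simp add: card_gt_0_iff)
  have ey: "exp y = ?Z / card A" unfolding y_def using Z c by simp
  have t: "t * exp t \<ge> exp t - 1" for t :: real
  proof -
    have "1 - t \<le> exp (- t)" using exp_ge_add_one_self[of "-t"] by simp
    then have "(1 - t) * exp t \<le> exp (-t) * exp t" by (intro mult_right_mono) auto
    then show ?thesis by (simp add: algebra_simps flip: exp_add)
  qed
  have "0 = ?Z / exp y - card A" using Z c by (simp add: ey)
  also have "\<dots> = (\<Sum>x\<in>A. exp (q x - y) - 1)"
    by (simp add: sum_subtractf exp_diff sum_divide_distrib)
  also have "\<dots> \<le> (\<Sum>x\<in>A. (q x - y) * exp (q x - y))" by (intro sum_mono t)
  also have "\<dots> = ((\<Sum>x\<in>A. exp (q x) * q x) - y * ?Z) / exp y"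
    by (simp add: exp_diff sum_divide_distrib sum_subtractf sum_distrib_left algebra_simps diff_divide_distrib)
  finally have "y * ?Z \<le> (\<Sum>x\<in>A. exp (q x) * q x)" by (simp add: field_simps)
  then show ?thesis using Z by (simp add: expec_expmech[OF assms] y_def[symmetric] field_simps)
qed

text \<open>Jensen's inequality on top of Gibbs: the tangent of \<open>exp\<close> at the uniform
  mean \<open>a\<close> bounds the partition function from below. Hence the mechanism is never worse
  on average than uniform sampling, which keeps \<open>S1\<close> at \<open>m / 2\<close> or
  more.\<close>

lemma expec_expmech_ge_mean:
  assumes "finite A" "A \<noteq> {}"
  shows "(\<Sum>x\<in>A. q x) / card A \<le> expec (expmech A q) q"
proof -
  define a where "a = (\<Sum>x\<in>A. q x) / card A"
  have c: "real (card A) > 0" using assms by (simp add: card_gt_0_iff)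
  have "(\<Sum>x\<in>A. q x) = a * card A" using c by (simp add: a_def)
  then have "exp a * card A = (\<Sum>x\<in>A. exp a * (1 + (q x - a)))"
    by (simp add: sum.distrib sum_subtractf algebra_simps flip: sum_distrib_left)
  also have "\<dots> \<le> (\<Sum>x\<in>A. exp a * exp (q x - a))"
    by (intro sum_mono mult_left_mono exp_ge_add_one_self) auto
  also have "\<dots> = (\<Sum>x\<in>A. exp (q x))" by (simp flip: exp_add)
  finally have "exp a \<le> (\<Sum>x\<in>A. exp (q x)) / card A" using c by (simp add: field_simps)
  then have "a \<le> ln ((\<Sum>x\<in>A. exp (q x)) / card A)"
    by (metis exp_gt_zero ln_exp ln_mono order_less_le_trans)
  then show ?thesis using expec_expmech_ge_ln_mean[OF assms, of q] by (simp add: a_def)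
qed

text \<open>Keeping only the term of \<open>x\<close> in the partition function costs
  \<open>ln (card A)\<close>, so the loss against the best element depends on the number of
  candidates alone.\<close>

lemma expec_expmech_ge:
  assumes "finite A" "x \<in> A"
  shows "q x - ln (card A) \<le> expec (expmech A q) q"
proof -
  have c: "real (card A) > 0" using assms by (auto simp: card_gt_0_iff)
  have "exp (q x) / card A \<le> (\<Sum>x\<in>A. exp (q x)) / card A"
    using assms by (intro divide_right_mono member_le_sum) auto
  then have "ln (exp (q x) / card A) \<le> ln ((\<Sum>x\<in>A. exp (q x)) / card A)"
    using c by (intro ln_mono) auto
  moreover have "ln (exp (q x) / card A) = q x - ln (card A)" using c by (subst ln_div) auto
  ultimately show ?thesis
    using expec_expmech_ge_ln_mean[of A q] assms by fastforce
qed

text \<open>The quartic touches \<open>\<bar>y\<bar>\<close> at \<open>0\<close> and at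
  \<open>\<bar>y\<bar> = l\<close>; the difference is a positive multiple of
  \<open>z * (z - l)\<^sup>2 * (z + 2 * l)\<close>. It turns second and fourth moments into a lower
  bound on the mean absolute value.\<close>

lemma abs_ge_quartic:
  fixes y l :: real
  assumes "l > 0"
  shows "\<bar>y\<bar> \<ge> (3 * l\<^sup>2 * y\<^sup>2 - y ^ 4) / (2 * l ^ 3)"
proof -
  define z where "z = \<bar>y\<bar>"
  have "0 \<le> z * (z - l)\<^sup>2 * (z + 2 * l)" unfolding z_def using assms by auto
  also have "\<dots> = 2 * l ^ 3 * z - 3 * l\<^sup>2 * z\<^sup>2 + z ^ 4"
    by (simp add: power2_eq_square power3_eq_cube power4_eq_xxxx algebra_simps)
  finally have "3 * l\<^sup>2 * y\<^sup>2 - y ^ 4 \<le> 2 * l ^ 3 * z"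
    unfolding z_def by (simp add: power_even_abs)
  then show ?thesis using assms by (simp add: z_def field_simps)
qed

section \<open>Moments of quadratic forms in random signs\<close>

definition avg :: "nat set \<Rightarrow> ((nat \<Rightarrow> int) \<Rightarrow> real) \<Rightarrow> real" where
  "avg W g = (\<Sum>s\<in>cuts W. g s) / 2 ^ card W"

lemma finite_cuts: "finite W \<Longrightarrow> finite (cuts W)"
  and cuts_nonempty: "cuts W \<noteq> {}"
  and card_cuts: "finite W \<Longrightarrow> card (cuts W) = 2 ^ card W"
  by (auto simp: cuts_def card_funcsetE PiE_eq_empty_iff numeral_2_eq_2 intro!: finite_PiE)

lemma cutsD: "s \<in> cuts W \<Longrightarrow> u \<in> W \<Longrightarrow> s u = -1 \<or> s u = 1"
  by (auto simp: cuts_def dest: PiE_mem)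

lemma expec_cuts: "finite W \<Longrightarrow> expec (pmf_of_set (cuts W)) g = avg W g"
  by (simp add: integral_pmf_of_set finite_cuts cuts_nonempty card_cuts avg_def)

lemma avg_mono:
  "(\<And>s. s \<in> cuts W \<Longrightarrow> f s \<le> g s) \<Longrightarrow> avg W f \<le> avg W g"
  by (auto simp: avg_def intro!: divide_right_mono sum_mono)

lemma avg_cong:
  "(\<And>s. s \<in> cuts W \<Longrightarrow> f s = g s) \<Longrightarrow> avg W f = avg W g"
  by (auto simp: avg_def)

lemma avg_add: "avg W (\<lambda>s. f s + g s) = avg W f + avg W g"
  and avg_diff: "avg W (\<lambda>s. f s - g s) = avg W f - avg W g"
  and avg_cmult: "avg W (\<lambda>s. c * f s) = c * avg W f"
  and avg_div: "avg W (\<lambda>s. f s / c) = avg W f / c"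
  and avg_sum: "avg W (\<lambda>s. \<Sum>i\<in>I. h i s) = (\<Sum>i\<in>I. avg W (h i))"
  by (auto simp: avg_def sum.distrib sum_subtractf add_divide_distrib diff_divide_distrib
      sum_distrib_left sum_divide_distrib mult.commute intro: sum.swap)

lemma avg_const: "finite W \<Longrightarrow> avg W (\<lambda>_. c) = c"
  by (simp add: avg_def card_cuts)

lemma avg_empty: "avg {} g = g (\<lambda>_. undefined)"
  by (simp add: avg_def cuts_def)

text \<open>Conditioning on the sign of one vertex. Both moment inductions run on this recursion, in
  which odd powers of the new sign cancel.\<close>

lemma avg_insert:
  assumes "finite W" "x \<notin> W"
  shows "avg (insert x W) g = avg W (\<lambda>s. (g (s(x := 1)) + g (s(x := -1))) / 2)"
proof -
  have "(\<Sum>s\<in>cuts (insert x W). g s) = (\<Sum>(y, s)\<in>{-1, 1} \<times> cuts W. g (s(x := y)))"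
    unfolding cuts_def PiE_insert_eq
    by (subst sum.reindex[OF inj_combinator[OF assms(2)]]) (simp add: case_prod_unfold o_def)
  also have "\<dots> = (\<Sum>s\<in>cuts W. g (s(x := 1)) + g (s(x := -1)))"
    by (simp add: sum.cartesian_product[symmetric] sum.distrib)
  finally show ?thesis using assms
    by (simp add: avg_def sum_divide_distrib[symmetric] field_simps)
qed

lemma avg_superset:
  assumes "finite W" "finite I" "W \<inter> I = {}"
    and "\<And>s x y. x \<in> I \<Longrightarrow> g (s(x := y)) = g s"
  shows "avg (I \<union> W) g = avg W g"
  using assms(2,3,4)
proof (induction I rule: finite_induct)
  case (insert x I)
  have "avg (insert x (I \<union> W)) g = avg (I \<union> W) (\<lambda>s. (g (s(x := 1)) + g (s(x := -1))) / 2)"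
    using insert assms(1) by (intro avg_insert) auto
  then show ?case using insert by simp
qed simp

definition flip :: "nat set \<Rightarrow> (nat \<Rightarrow> int) \<Rightarrow> nat \<Rightarrow> int" where
  "flip F s = (\<lambda>v. if v \<in> F then - s v else s v)"

lemma flip_flip: "flip F (flip F s) = s"
  by (auto simp: flip_def)

text \<open>\<open>flip F\<close> is an involution; \<open>F \<subseteq> W\<close> matters because
  the fixed value of a cut outside \<open>W\<close> must stay untouched. Every exact probability
  \<open>1 / 2\<close> for an edge to be cut comes from this symmetry.\<close>

lemma sum_cuts_flip:
  assumes "F \<subseteq> W"
  shows "(\<Sum>s\<in>cuts W. h (flip F s)) = (\<Sum>s\<in>cuts W. h s)"
proof (rule sum.reindex_bij_witness[of _ "flip F" "flip F"])
  fix s assume s: "s \<in> cuts W"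
  show "flip F s \<in> cuts W"
    using s assms unfolding cuts_def PiE_iff extensional_def flip_def by (force simp: minus_equation_iff)
  then show "flip F s \<in> cuts W" .
qed (auto simp: flip_flip)

text \<open>Independent signs are orthogonal, which gives the second moment exactly; for the fourth,
  raising the coefficient of \<open>(a x) ^ 4\<close> from 1 to 3 completes a square. Affine forms
  are treated separately because the coefficient of one sign in a quadratic form is affine in the
  other signs.\<close>

lemma fourth_moment_affine:
  fixes a :: "nat \<Rightarrow> real" and c :: real
  assumes "finite W"
  defines "L \<equiv> \<lambda>W s. c + (\<Sum>v\<in>W. a v * real_of_int (s v))"
  shows "avg W (\<lambda>s. (L W s)\<^sup>2) = c\<^sup>2 + (\<Sum>v\<in>W. (a v)\<^sup>2)"
    and "avg W (\<lambda>s. (L W s) ^ 4) \<le> 3 * (c\<^sup>2 + (\<Sum>v\<in>W. (a v)\<^sup>2))\<^sup>2"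
proof -
  have "avg W (\<lambda>s. (L W s)\<^sup>2) = c\<^sup>2 + (\<Sum>v\<in>W. (a v)\<^sup>2) \<and>
     avg W (\<lambda>s. (L W s) ^ 4) \<le> 3 * (c\<^sup>2 + (\<Sum>v\<in>W. (a v)\<^sup>2))\<^sup>2"
    using assms(1)
  proof (induction W rule: finite_induct)
    case empty
    then show ?case by (simp add: L_def avg_empty flip: power_mult)
  next
    case (insert x W)
    have u: "L (insert x W) (s(x := y)) = L W s + a x * real_of_int y" for s y
      using insert by (auto simp: L_def intro!: sum.cong)
    let ?r = "c\<^sup>2 + (\<Sum>v\<in>W. (a v)\<^sup>2)"
    have 2: "((z + b)\<^sup>2 + (z - b)\<^sup>2) / 2 = z\<^sup>2 + b\<^sup>2" for z b :: real
      by (simp add: power2_eq_square algebra_simps)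
    have 4: "((z + b) ^ 4 + (z - b) ^ 4) / 2 = z ^ 4 + 6 * b\<^sup>2 * z\<^sup>2 + b ^ 4" for z b :: real
      by (simp add: power2_eq_square power4_eq_xxxx algebra_simps)
    have e2: "avg (insert x W) (\<lambda>s. (L (insert x W) s)\<^sup>2) = ?r + (a x)\<^sup>2"
      using insert by (simp add: avg_insert u 2 avg_add avg_const)
    have "avg (insert x W) (\<lambda>s. (L (insert x W) s) ^ 4)
        = avg W (\<lambda>s. (L W s) ^ 4) + 6 * (a x)\<^sup>2 * ?r + (a x) ^ 4"
      using insert by (simp add: avg_insert u 4 avg_add avg_const avg_cmult)
    also have "\<dots> \<le> 3 * ?r\<^sup>2 + 6 * (a x)\<^sup>2 * ?r + 3 * (a x) ^ 4"
      using insert.IH by (intro add_mono) auto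
    also have "\<dots> = 3 * (?r + (a x)\<^sup>2)\<^sup>2"
      by (simp add: power2_eq_square power4_eq_xxxx algebra_simps)
    finally show ?case using e2 insert by (simp add: algebra_simps)
  qed
  then show "avg W (\<lambda>s. (L W s)\<^sup>2) = c\<^sup>2 + (\<Sum>v\<in>W. (a v)\<^sup>2)"
    and "avg W (\<lambda>s. (L W s) ^ 4) \<le> 3 * (c\<^sup>2 + (\<Sum>v\<in>W. (a v)\<^sup>2))\<^sup>2" by auto
qed

lemma avg_Cauchy_Schwarz: "(avg W (\<lambda>s. f s * g s))\<^sup>2 \<le> avg W (\<lambda>s. (f s)\<^sup>2) * avg W (\<lambda>s. (g s)\<^sup>2)"
  using Cauchy_Schwarz_ineq_sum[of f g "cuts W"]
  by (simp add: avg_def power_divide divide_right_mono flip: power2_eq_square)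

text \<open>The constant 27 is what the inductive step \<open>(Q + x L)^4\<close> reproduces, given the constant 3 for
  the affine form \<open>L\<close>: \<open>6 sqrt (27 * 3) = 2 * 27\<close>.\<close>

lemma fourth_moment_quadratic:
  fixes a :: "nat \<Rightarrow> real" and b :: "nat \<Rightarrow> nat \<Rightarrow> real" and c :: real
  assumes "finite W" and sym: "\<And>u v. b u v = b v u" and diag: "\<And>v. b v v = 0"
  defines "Q \<equiv> \<lambda>W s. c + (\<Sum>v\<in>W. a v * real_of_int (s v))
                 + (\<Sum>u\<in>W. \<Sum>v\<in>W. b u v * real_of_int (s u) * real_of_int (s v)) / 2"
    and "R \<equiv> \<lambda>W. c\<^sup>2 + (\<Sum>v\<in>W. (a v)\<^sup>2) + (\<Sum>u\<in>W. \<Sum>v\<in>W. (b u v)\<^sup>2) / 2"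
  shows "avg W (\<lambda>s. (Q W s)\<^sup>2) = R W" and "avg W (\<lambda>s. (Q W s) ^ 4) \<le> 27 * (R W)\<^sup>2"
proof -
  have "avg W (\<lambda>s. (Q W s)\<^sup>2) = R W \<and> avg W (\<lambda>s. (Q W s) ^ 4) \<le> 27 * (R W)\<^sup>2"
    using assms(1)
  proof (induction W rule: finite_induct)
    case empty
    then show ?case by (simp add: Q_def R_def avg_empty flip: power_mult)
  next
    case (insert x W)
    define L where "L = (\<lambda>s. a x + (\<Sum>v\<in>W. b x v * real_of_int (s v)))"
    define l where "l = (a x)\<^sup>2 + (\<Sum>v\<in>W. (b x v)\<^sup>2)"
    have L2: "avg W (\<lambda>s. (L s)\<^sup>2) = l" and L4: "avg W (\<lambda>s. (L s) ^ 4) \<le> 3 * l\<^sup>2"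
      using fourth_moment_affine[where W=W and a="b x" and c="a x"] insert by (auto simp: L_def l_def)
    have l0: "l \<ge> 0" unfolding l_def by (simp add: sum_nonneg)
    have R0: "R W \<ge> 0" unfolding R_def by (simp add: sum_nonneg)
    have symx: "b v x = b x v" if "v \<in> W" for v by (rule sym)
    \<comment> \<open>The double sum sees each pair involving \<open>x\<close> in both orders, which
      the division by 2 undoes; \<open>diag\<close> removes the pair of \<open>x\<close> with
      itself.\<close>
    have Rx: "R (insert x W) = R W + l"
      using insert by (simp add: symx R_def l_def diag sum.distrib)
    have u: "Q (insert x W) (s(x := y)) = Q W s + real_of_int y * L s" for s y
    proof -
      have nx: "v \<noteq> x" if "v \<in> W" for v using that insert by auto
      have "(\<Sum>v\<in>W. a v * real_of_int ((s(x := y)) v)) = (\<Sum>v\<in>W. a v * real_of_int (s v))"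
        using nx by (intro sum.cong) auto
      moreover have "(\<Sum>u\<in>W. \<Sum>v\<in>W. b u v * real_of_int ((s(x := y)) u) * real_of_int ((s(x := y)) v))
        = (\<Sum>u\<in>W. \<Sum>v\<in>W. b u v * real_of_int (s u) * real_of_int (s v))"
        using nx by (intro sum.cong) auto
      moreover have "(\<Sum>v\<in>W. b v x * real_of_int ((s(x := y)) v) * real_of_int y)
         = real_of_int y * (\<Sum>v\<in>W. b x v * real_of_int (s v))"
        using nx by (auto simp: sum_distrib_left symx mult_ac intro!: sum.cong)
      moreover have "(\<Sum>v\<in>W. b x v * real_of_int y * real_of_int ((s(x := y)) v))
         = real_of_int y * (\<Sum>v\<in>W. b x v * real_of_int (s v))"
        using nx by (auto simp: sum_distrib_left mult_ac intro!: sum.cong)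
      ultimately show ?thesis using insert
        by (simp add: Q_def L_def diag sum.distrib algebra_simps)
    qed
    have 2: "((z + b)\<^sup>2 + (z - b)\<^sup>2) / 2 = z\<^sup>2 + b\<^sup>2" for z b :: real
      by (simp add: power2_eq_square algebra_simps)
    have 4: "((z + b) ^ 4 + (z - b) ^ 4) / 2 = z ^ 4 + 6 * (z\<^sup>2 * b\<^sup>2) + b ^ 4" for z b :: real
      by (simp add: power2_eq_square power4_eq_xxxx algebra_simps)
    have e2: "avg (insert x W) (\<lambda>s. (Q (insert x W) s)\<^sup>2) = R W + l"
      using insert by (simp add: avg_insert u 2 avg_add L2)
    have "(avg W (\<lambda>s. (Q W s)\<^sup>2 * (L s)\<^sup>2))\<^sup>2
        \<le> avg W (\<lambda>s. ((Q W s)\<^sup>2)\<^sup>2) * avg W (\<lambda>s. ((L s)\<^sup>2)\<^sup>2)"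
      by (rule avg_Cauchy_Schwarz)
    also have "\<dots> \<le> (27 * (R W)\<^sup>2) * (3 * l\<^sup>2)"
      using insert.IH L4 by (intro mult_mono) (auto simp: avg_def intro!: sum_nonneg divide_nonneg_nonneg simp flip: power_mult)
    also have "\<dots> = (9 * R W * l)\<^sup>2" by (simp add: power_mult_distrib)
    finally have cs: "avg W (\<lambda>s. (Q W s)\<^sup>2 * (L s)\<^sup>2) \<le> 9 * R W * l"
      by (rule power2_le_imp_le) (use R0 l0 in simp)
    have "avg (insert x W) (\<lambda>s. (Q (insert x W) s) ^ 4)
        = avg W (\<lambda>s. (Q W s) ^ 4) + 6 * avg W (\<lambda>s. (Q W s)\<^sup>2 * (L s)\<^sup>2) + avg W (\<lambda>s. (L s) ^ 4)"
      using insert by (simp add: avg_insert u 4 avg_add avg_cmult)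
    also have "\<dots> \<le> 27 * (R W)\<^sup>2 + 6 * (9 * R W * l) + 3 * l\<^sup>2"
      using insert.IH cs L4 by (intro add_mono mult_left_mono) auto
    also have "\<dots> \<le> 27 * (R W + l)\<^sup>2"
      by (simp add: power2_eq_square algebra_simps)
    finally show ?case using e2 by (simp add: Rx)
  qed
  then show "avg W (\<lambda>s. (Q W s)\<^sup>2) = R W" and "avg W (\<lambda>s. (Q W s) ^ 4) \<le> 27 * (R W)\<^sup>2" by auto
qed

text \<open>The choice \<open>l = sqrt (K * r)\<close> maximises
  \<open>(3 * l\<^sup>2 * r - K * r\<^sup>2) / (2 * l ^ 3)\<close>, the averaged quartic bound; its
  value there is \<open>r / l = sqrt (r / K)\<close>.\<close>

lemma avg_abs_ge:
  assumes "avg W (\<lambda>s. (f s)\<^sup>2) = r" "avg W (\<lambda>s. (f s) ^ 4) \<le> K * r\<^sup>2" "r > 0" "K > 0"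
  shows "avg W (\<lambda>s. \<bar>f s\<bar>) \<ge> sqrt (r / K)"
proof -
  define l where "l = sqrt (K * r)"
  have l: "l > 0" "l\<^sup>2 = K * r" using assms by (auto simp: l_def)
  have l3: "l ^ 3 = l * (K * r)" using l(2) by (simp add: power3_eq_cube power2_eq_square)
  have "sqrt (r / K) * l = r" using assms
    by (simp add: l_def flip: real_sqrt_mult)
  then have "sqrt (r / K) = r / l" using l by (simp add: field_simps)
  also have "\<dots> = (3 * l\<^sup>2 * r - K * r\<^sup>2) / (2 * l ^ 3)"
    using assms l(1) unfolding l(2) l3 by (simp add: field_simps power2_eq_square)
  also have "\<dots> \<le> (3 * l\<^sup>2 * avg W (\<lambda>s. (f s)\<^sup>2) - avg W (\<lambda>s. (f s) ^ 4)) / (2 * l ^ 3)"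
    using assms l by (intro divide_right_mono diff_mono) auto
  also have "\<dots> = avg W (\<lambda>s. (3 * l\<^sup>2 * (f s)\<^sup>2 - (f s) ^ 4) / (2 * l ^ 3))"
    by (simp add: avg_div avg_diff avg_cmult)
  also have "\<dots> \<le> avg W (\<lambda>s. \<bar>f s\<bar>)"
    by (intro avg_mono abs_ge_quartic l)
  finally show ?thesis .
qed

section \<open>Random cuts\<close>

definition cutind :: "nat set \<Rightarrow> (nat \<Rightarrow> int) \<Rightarrow> real" where
  "cutind e S = (if \<exists>u v. e = {u, v} \<and> S u \<noteq> S v then 1 else 0)"

lemma cutind_edge: "cutind {u, v} S = (if S u \<noteq> S v then 1 else 0)"
  by (auto simp: cutind_def doubleton_eq_iff)

lemma cutind_cong: "(\<And>x. x \<in> e \<Longrightarrow> S x = T x) \<Longrightarrow> cutind e S = cutind e T"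
  unfolding cutind_def by (metis insert_iff)

lemma val_eq_sum: "finite H \<Longrightarrow> real (val H S) = (\<Sum>e\<in>H. cutind e S)"
  by (simp add: val_def cutind_def sum.If_cases Int_def)

lemma finite_simple_graph: "simple_graph n E \<Longrightarrow> finite E"
  by (rule finite_subset[of _ "Pow {..<n}"]) (auto simp: simple_graph_def)

lemma simple_graph_edgeE:
  assumes "simple_graph n E" "e \<in> E"
  obtains u v where "e = {u, v}" "u \<noteq> v" "u < n" "v < n"
  using assms unfolding simple_graph_def by blast

lemma simple_graph_edgeD: "simple_graph n E \<Longrightarrow> {u, v} \<in> E \<Longrightarrow> u \<noteq> v \<and> u < n \<and> v < n"
  by (elim simple_graph_edgeE) (auto simp: doubleton_eq_iff)

text \<open>An edge arises from two orientations, whence the division by 2. Sums over vertex pairs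
  are the shape that the moment bounds for quadratic forms require.\<close>

lemma sum_edges_ordered_pairs:
  fixes g :: "nat set \<Rightarrow> real"
  assumes "simple_graph n E"
  shows "(\<Sum>e | e \<in> E \<and> e \<subseteq> W. g e)
    = (\<Sum>u\<in>W \<inter> {..<n}. \<Sum>v\<in>W \<inter> {..<n}. if {u, v} \<in> E then g {u, v} else 0) / 2"
proof -
  let ?E = "{e. e \<in> E \<and> e \<subseteq> W}" and ?W = "W \<inter> {..<n}"
  let ?P = "{(u, v) \<in> ?W \<times> ?W. {u, v} \<in> E}"
  have fin: "finite ?E" "finite ?P"
    using finite_simple_graph[OF assms] by (auto intro: finite_subset[of _ "?W \<times> ?W"])
  have "(\<Sum>u\<in>?W. \<Sum>v\<in>?W. if {u, v} \<in> E then g {u, v} else 0)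
      = (\<Sum>p\<in>?W \<times> ?W. if {fst p, snd p} \<in> E then g {fst p, snd p} else 0)"
    by (simp add: sum.cartesian_product case_prod_unfold)
  also have "\<dots> = (\<Sum>p\<in>?P. g {fst p, snd p})"
    by (subst sum.inter_filter[symmetric]) (auto intro!: sum.cong)
  also have "\<dots> = (\<Sum>e\<in>?E. \<Sum>p | p \<in> ?P \<and> {fst p, snd p} = e. g {fst p, snd p})"
    using fin by (subst sum.group) (auto)
  also have "\<dots> = (\<Sum>e\<in>?E. 2 * g e)"
  proof (intro sum.cong refl)
    fix e assume e: "e \<in> ?E"
    then obtain u v where uv: "e = {u, v}" "u \<noteq> v" "u < n" "v < n"
      using assms by (auto elim: simple_graph_edgeE)
    have "{p. p \<in> ?P \<and> {fst p, snd p} = e} = {(u, v), (v, u)}"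
      using e uv by (auto simp: doubleton_eq_iff insert_commute)
    then show "(\<Sum>p | p \<in> ?P \<and> {fst p, snd p} = e. g {fst p, snd p}) = 2 * g e"
      using uv by (simp add: insert_commute)
  qed
  finally show ?thesis by (simp flip: sum_distrib_left)
qed

lemma sum_degrees:
  assumes "simple_graph n E"
  shows "(\<Sum>v<n. real (degree E v)) = 2 * card E"
proof -
  have fin: "finite E" using assms by (rule finite_simple_graph)
  have "(\<Sum>v<n. real (degree E v)) = (\<Sum>v<n. \<Sum>e\<in>E. if v \<in> e then 1 else 0)"
    using fin by (simp add: degree_def sum.If_cases Int_def)
  also have "\<dots> = (\<Sum>e\<in>E. \<Sum>v<n. if v \<in> e then 1 else 0)" by (rule sum.swap)
  also have "\<dots> = (\<Sum>e\<in>E. 2)"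
  proof (intro sum.cong refl)
    fix e assume "e \<in> E"
    then obtain u v where "e = {u, v}" "u \<noteq> v" "u < n" "v < n"
      using assms by (auto elim: simple_graph_edgeE)
    moreover from this have "{..<n} \<inter> {w. w \<in> e} = {u, v}" by auto
    ultimately show "(\<Sum>v<n. if v \<in> e then 1 else (0::real)) = 2"
      by (simp add: sum.If_cases)
  qed
  finally show ?thesis by simp
qed

definition glue :: "nat set \<Rightarrow> (nat \<Rightarrow> int) \<Rightarrow> (nat \<Rightarrow> int) \<Rightarrow> nat \<Rightarrow> int" where
  "glue U \<sigma> s = (\<lambda>v. if v \<in> U then \<sigma> v else s v)"

text \<open>For signs \<open>x\<close> and \<open>y\<close> the indicator of a cut edge is
  \<open>(1 - x * y) / 2\<close>. With \<open>\<sigma>\<close> frozen on \<open>U\<close>, edges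
  inside \<open>U\<close> contribute only to the constant, edges between \<open>U\<close> and
  \<open>W\<close> also to the linear part, and edges inside \<open>W\<close> to the quadratic
  part.\<close>

lemma val_glue_quadratic:
  assumes G: "simple_graph n E" and UW: "U \<union> W = {..<n}" "U \<inter> W = {}"
    and \<sigma>: "\<sigma> \<in> cuts U" and s: "s \<in> cuts W"
  defines "adj \<equiv> \<lambda>u v. of_bool ({u, v} \<in> E) :: real"
  shows "real (val E (glue U \<sigma> s)) =
     ((\<Sum>u\<in>U. \<Sum>v\<in>U. adj u v * (1 - \<sigma> u * \<sigma> v)) / 4 + (\<Sum>u\<in>U. \<Sum>v\<in>W. adj u v) / 2
        + (\<Sum>u\<in>W. \<Sum>v\<in>W. adj u v) / 4)
     + (\<Sum>v\<in>W. - (\<Sum>u\<in>U. adj u v * \<sigma> u) / 2 * s v)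
     + (\<Sum>u\<in>W. \<Sum>v\<in>W. - adj u v / 2 * s u * s v) / 2"
proof -
  let ?S = "glue U \<sigma> s"
  have fin: "finite U" "finite W" using UW by (metis finite_Un finite_lessThan)+
  have sym: "adj u v = adj v u" for u v by (simp add: adj_def insert_commute)
  have pm: "?S v = -1 \<or> ?S v = 1" if "v < n" for v
    using that UW \<sigma> s cutsD[of \<sigma> U v] cutsD[of s W v] by (auto simp: glue_def)
  have "real (val E ?S) = (\<Sum>e | e \<in> E \<and> e \<subseteq> {..<n}. cutind e ?S)"
    using val_eq_sum[OF finite_simple_graph[OF G]] G
    by (auto intro!: sum.cong elim: simple_graph_edgeE)
  also have "\<dots> = (\<Sum>u<n. \<Sum>v<n. if {u, v} \<in> E then cutind {u, v} ?S else 0) / 2"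
    by (subst sum_edges_ordered_pairs[OF G]) simp
  also have "\<dots> = (\<Sum>u<n. \<Sum>v<n. adj u v * (1 - ?S u * ?S v) / 2) / 2"
  proof -
    have "(if {u, v} \<in> E then cutind {u, v} ?S else 0) = adj u v * (1 - ?S u * ?S v) / 2"
      if "u < n" "v < n" for u v
      using pm[OF that(1)] pm[OF that(2)] by (auto simp: cutind_edge adj_def)
    then show ?thesis by (intro arg_cong2[of _ _ _ _ "(/)"] sum.cong refl) auto
  qed
  also have "\<dots> = (\<Sum>u\<in>U \<union> W. \<Sum>v\<in>U \<union> W. adj u v * (1 - ?S u * ?S v)) / 4"
    by (simp add: UW(1) flip: sum_divide_distrib)
  also have "(\<Sum>u\<in>U \<union> W. \<Sum>v\<in>U \<union> W. adj u v * (1 - ?S u * ?S v))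
     = (\<Sum>u\<in>U. \<Sum>v\<in>U. adj u v * (1 - ?S u * ?S v)) + (\<Sum>u\<in>U. \<Sum>v\<in>W. adj u v * (1 - ?S u * ?S v))
     + ((\<Sum>u\<in>W. \<Sum>v\<in>U. adj u v * (1 - ?S u * ?S v)) + (\<Sum>u\<in>W. \<Sum>v\<in>W. adj u v * (1 - ?S u * ?S v)))"
    using fin UW(2) by (simp add: sum.union_disjoint sum.distrib)
  also have "(\<Sum>u\<in>W. \<Sum>v\<in>U. adj u v * (1 - ?S u * ?S v)) = (\<Sum>u\<in>U. \<Sum>v\<in>W. adj u v * (1 - ?S u * ?S v))"
    by (subst sum.swap) (simp add: sym mult.commute)
  also have "(\<Sum>u\<in>U. \<Sum>v\<in>U. adj u v * (1 - ?S u * ?S v)) = (\<Sum>u\<in>U. \<Sum>v\<in>U. adj u v * (1 - \<sigma> u * \<sigma> v))"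
    by (simp add: glue_def)
  also have "(\<Sum>u\<in>U. \<Sum>v\<in>W. adj u v * (1 - ?S u * ?S v))
      = (\<Sum>u\<in>U. \<Sum>v\<in>W. adj u v) - (\<Sum>u\<in>U. \<Sum>v\<in>W. adj u v * \<sigma> u * s v)"
    using UW(2) by (auto simp: glue_def algebra_simps sum_subtractf[symmetric] intro!: sum.cong)
  also have "(\<Sum>u\<in>U. \<Sum>v\<in>W. adj u v * \<sigma> u * s v) = (\<Sum>v\<in>W. (\<Sum>u\<in>U. adj u v * \<sigma> u) * s v)"
    by (subst sum.swap) (simp add: sum_distrib_right)
  also have "(\<Sum>u\<in>W. \<Sum>v\<in>W. adj u v * (1 - ?S u * ?S v))
      = (\<Sum>u\<in>W. \<Sum>v\<in>W. adj u v) - (\<Sum>u\<in>W. \<Sum>v\<in>W. adj u v * s u * s v)"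
    using UW(2) by (auto simp: glue_def algebra_simps sum_subtractf[symmetric] intro!: sum.cong)
  finally show ?thesis
    by (simp add: sum_negf sum_divide_distrib[symmetric] add_divide_distrib diff_divide_distrib)
qed

text \<open>Anticoncentration around every \<open>t\<close>, so that \<open>t\<close> can later be
  the value of an independent cut. Each edge inside \<open>W\<close> has quadratic coefficient
  \<open>- 1 / 2\<close> and adds \<open>1 / 4\<close> to the second moment; constant and linear
  parts can only increase it. With the constant 27 this gives \<open>108 = 4 * 27\<close>.\<close>

lemma avg_abs_val_glue_ge:
  assumes G: "simple_graph n E" and UW: "U \<union> W = {..<n}" "U \<inter> W = {}" and \<sigma>: "\<sigma> \<in> cuts U"
  shows "sqrt (real (card {e \<in> E. e \<subseteq> W}) / 108) \<le> avg W (\<lambda>s. \<bar>real (val E (glue U \<sigma> s)) - t\<bar>)"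
proof (cases "card {e \<in> E. e \<subseteq> W} = 0")
  case True
  then show ?thesis by (simp add: avg_def sum_nonneg)
next
  case False
  define adj :: "nat \<Rightarrow> nat \<Rightarrow> real" where "adj = (\<lambda>u v. of_bool ({u, v} \<in> E))"
  have fin: "finite W" using UW by (metis finite_Un finite_lessThan)
  have Wn: "W \<inter> {..<n} = W" using UW by auto
  define c where "c = (\<Sum>u\<in>U. \<Sum>v\<in>U. adj u v * (1 - \<sigma> u * \<sigma> v)) / 4 + (\<Sum>u\<in>U. \<Sum>v\<in>W. adj u v) / 2
        + (\<Sum>u\<in>W. \<Sum>v\<in>W. adj u v) / 4 - t"
  define a where "a = (\<lambda>v. - (\<Sum>u\<in>U. adj u v * real_of_int (\<sigma> u)) / 2)"
  define b where "b = (\<lambda>u v. - adj u v / 2)"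
  define f where "f = (\<lambda>s. c + (\<Sum>v\<in>W. a v * real_of_int (s v))
                 + (\<Sum>u\<in>W. \<Sum>v\<in>W. b u v * real_of_int (s u) * real_of_int (s v)) / 2)"
  define R where "R = c\<^sup>2 + (\<Sum>v\<in>W. (a v)\<^sup>2) + (\<Sum>u\<in>W. \<Sum>v\<in>W. (b u v)\<^sup>2) / 2"
  have bs: "b u v = b v u" for u v by (simp add: b_def adj_def insert_commute)
  have bd: "b v v = 0" for v using simple_graph_edgeD[OF G, of v v] by (auto simp: b_def adj_def)
  have f: "avg W (\<lambda>s. \<bar>real (val E (glue U \<sigma> s)) - t\<bar>) = avg W (\<lambda>s. \<bar>f s\<bar>)"
    by (intro avg_cong) (simp add: val_glue_quadratic[OF G UW \<sigma>] f_def c_def a_def b_def adj_def)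
  have "(\<Sum>u\<in>W. \<Sum>v\<in>W. (b u v)\<^sup>2) = (\<Sum>u\<in>W. \<Sum>v\<in>W. if {u, v} \<in> E then 1 else 0) / 4"
    by (auto simp: b_def adj_def power2_eq_square sum_divide_distrib intro!: sum.cong)
  also have "\<dots> = real (card {e \<in> E. e \<subseteq> W}) / 2"
    using sum_edges_ordered_pairs[OF G, where W=W and g="\<lambda>_. 1"] by (simp add: Wn)
  finally have "real (card {e \<in> E. e \<subseteq> W}) / 4 \<le> R"
    using sum_nonneg[of W "\<lambda>v. (a v)\<^sup>2", OF zero_le_power2] zero_le_power2[of c] unfolding R_def by linarith
  then have R: "real (card {e \<in> E. e \<subseteq> W}) / 108 \<le> R / 27" "R > 0" using False by linarith+
  have "sqrt (real (card {e \<in> E. e \<subseteq> W}) / 108) \<le> sqrt (R / 27)" using R by simp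
  also have "\<dots> \<le> avg W (\<lambda>s. \<bar>f s\<bar>)"
    using fourth_moment_quadratic[of W b c a] fin bs bd R
    by (intro avg_abs_ge) (auto simp: f_def R_def)
  finally show ?thesis by (simp add: f)
qed

section \<open>Sign-flip symmetries, and the exponential mechanism guided by a matching\<close>

lemma cutind_flip:
  assumes "u \<in> F" "v \<notin> F" "s u = -1 \<or> s u = 1" "s v = -1 \<or> s v = 1"
  shows "cutind {u, v} (flip F s) = 1 - cutind {u, v} s"
  using assms by (auto simp: cutind_edge flip_def)

text \<open>Flipping the free vertex \<open>u\<close> alone exchanges cut and uncut, whether
  \<open>v\<close> is frozen or free.\<close>

lemma avg_cutind_glue:
  assumes "finite W" "u \<in> W" "U \<inter> W = {}" "v \<in> U \<union> W" "u \<noteq> v" "\<sigma> \<in> cuts U"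
  shows "avg W (\<lambda>s. cutind {u, v} (glue U \<sigma> s)) = 1 / 2"
proof -
  have m: "glue U \<sigma> (flip {u} s) = flip {u} (glue U \<sigma> s)" for s
    using assms by (auto simp: glue_def flip_def intro!: ext)
  have "avg W (\<lambda>s. cutind {u, v} (glue U \<sigma> s)) = avg W (\<lambda>s. cutind {u, v} (glue U \<sigma> (flip {u} s)))"
    unfolding avg_def using assms by (subst sum_cuts_flip) auto
  also have "\<dots> = avg W (\<lambda>s. 1 - cutind {u, v} (glue U \<sigma> s))"
  proof (intro avg_cong)
    fix s assume "s \<in> cuts W"
    then show "cutind {u, v} (glue U \<sigma> (flip {u} s)) = 1 - cutind {u, v} (glue U \<sigma> s)"
      unfolding m using assms cutsD[of s W] cutsD[of \<sigma> U]
      by (intro cutind_flip) (auto simp: glue_def)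
  qed
  finally show ?thesis using assms by (simp add: avg_diff avg_const)
qed

lemma avg_val_glue:
  assumes G: "simple_graph n E" and UW: "U \<union> W = {..<n}" "U \<inter> W = {}" and \<sigma>: "\<sigma> \<in> cuts U"
  shows "avg W (\<lambda>s. real (val E (glue U \<sigma> s)))
    = real (val {e \<in> E. e \<subseteq> U} \<sigma>) + real (card {e \<in> E. \<not> e \<subseteq> U}) / 2"
proof -
  have fin: "finite E" "finite W"
    using finite_simple_graph[OF G] UW by (auto, metis finite_Un finite_lessThan)
  have in_U: "avg W (\<lambda>s. cutind e (glue U \<sigma> s)) = cutind e \<sigma>" if "e \<subseteq> U" for e
  proof -
    have "cutind e (glue U \<sigma> s) = cutind e \<sigma>" for s
      using that by (intro cutind_cong) (auto simp: glue_def)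
    then show ?thesis using fin by (simp add: avg_const)
  qed
  have not_in: "avg W (\<lambda>s. cutind e (glue U \<sigma> s)) = 1 / 2" if "e \<in> E" "\<not> e \<subseteq> U" for e
  proof -
    obtain u v where e: "e = {u, v}" "u \<noteq> v" "u < n" "v < n"
      using G \<open>e \<in> E\<close> by (auto elim: simple_graph_edgeE)
    have uv: "u \<in> U \<union> W" "v \<in> U \<union> W" using e UW by auto
    show ?thesis
    proof (cases "u \<in> W")
      case True
      then show ?thesis using uv e fin UW \<sigma> avg_cutind_glue[of W u U v \<sigma>] by auto
    next
      case False
      then have "v \<in> W" using that e uv by auto
      then show ?thesis using uv e fin UW \<sigma> avg_cutind_glue[of W v U u \<sigma>]
        by (auto simp: insert_commute)
    qed
  qed
  have "avg W (\<lambda>s. real (val E (glue U \<sigma> s))) = (\<Sum>e\<in>E. avg W (\<lambda>s. cutind e (glue U \<sigma> s)))"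
    by (simp add: val_eq_sum fin avg_sum)
  also have "\<dots> = (\<Sum>e\<in>E. if e \<subseteq> U then cutind e \<sigma> else 1 / 2)"
    using in_U not_in by (intro sum.cong) auto
  also have "\<dots> = real (val {e \<in> E. e \<subseteq> U} \<sigma>) + real (card {e \<in> E. \<not> e \<subseteq> U}) / 2"
  proof -
    have "E \<inter> {e. e \<subseteq> U} = {e \<in> E. e \<subseteq> U}" "E \<inter> - {e. e \<subseteq> U} = {e \<in> E. \<not> e \<subseteq> U}" by auto
    then show ?thesis using fin by (simp add: sum.If_cases val_eq_sum)
  qed
  finally show ?thesis .
qed

lemma avg_val_inner:
  assumes "finite W" "finite H" and "\<And>e. e \<in> H \<Longrightarrow> \<exists>u v. e = {u, v} \<and> u \<noteq> v \<and> u \<in> W \<and> v \<in> W"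
  shows "avg W (\<lambda>s. real (val H s)) = real (card H) / 2"
proof -
  have "avg W (\<lambda>s. cutind e s) = 1 / 2" if e: "e \<in> H" for e
  proof -
    obtain u v where "e = {u, v}" "u \<noteq> v" "u \<in> W" "v \<in> W" using assms(3)[OF e] by blast
    then show ?thesis using avg_cutind_glue[of W u "{}" v "\<lambda>_. undefined"] assms
      by (simp add: glue_def cuts_def)
  qed
  then have "(\<Sum>e\<in>H. avg W (cutind e)) = (\<Sum>e\<in>H. 1 / 2)" by (intro sum.cong) auto
  then show ?thesis using assms by (simp add: val_eq_sum avg_sum)
qed

text \<open>The flip pairs cuts of equal weight, and exactly one of each pair cuts the edge because
  \<open>F\<close> contains \<open>u\<close> but not \<open>v\<close>.\<close>

lemma expec_cutind_flip_invariant: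
  assumes "finite W" "F \<subseteq> W" "u \<in> F" "v \<in> W - F" and q: "\<And>s. s \<in> cuts W \<Longrightarrow> q (flip F s) = q s"
  shows "expec (expmech (cuts W) q) (cutind {u, v}) = 1 / 2"
proof -
  have fin: "finite (cuts W)" using assms by (simp add: finite_cuts)
  let ?Z = "\<Sum>s\<in>cuts W. exp (q s)" and ?A = "\<Sum>s\<in>cuts W. exp (q s) * cutind {u, v} s"
  have Z: "?Z > 0" using fin cuts_nonempty by (simp add: sum_pos)
  have "?A = (\<Sum>s\<in>cuts W. exp (q (flip F s)) * cutind {u, v} (flip F s))"
    using assms by (subst sum_cuts_flip) auto
  also have "\<dots> = (\<Sum>s\<in>cuts W. exp (q s) * (1 - cutind {u, v} s))"
    using assms cutsD[of _ W] by (intro sum.cong refl arg_cong2[of _ _ _ _ "(*)"] cutind_flip) auto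
  also have "\<dots> = ?Z - ?A" by (simp add: algebra_simps sum_subtractf)
  finally have "?A = ?Z / 2" by simp
  then show ?thesis using Z by (simp add: expec_expmech fin cuts_nonempty)
qed

lemma val_flip_matching:
  assumes "finite M" "\<And>e. e \<in> M \<Longrightarrow> e \<subseteq> F \<or> e \<inter> F = {}"
  shows "val M (flip F s) = val M s"
proof -
  have "cutind e (flip F s) = cutind e s" if "e \<in> M" for e
  proof -
    have "flip F s u \<noteq> flip F s v \<longleftrightarrow> s u \<noteq> s v" if "e = {u, v}" for u v
      using assms(2)[OF \<open>e \<in> M\<close>] that by (auto simp: flip_def)
    then have "(\<exists>u v. e = {u, v} \<and> flip F s u \<noteq> flip F s v) \<longleftrightarrow> (\<exists>u v. e = {u, v} \<and> s u \<noteq> s v)"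
      by metis
    then show ?thesis by (simp add: cutind_def)
  qed
  then have "real (val M (flip F s)) = real (val M s)" using assms by (simp add: val_eq_sum)
  then show ?thesis by simp
qed

text \<open>Weighting by a matching biases its own edges and no others: an unmatched edge keeps
  probability exactly \<open>1 / 2\<close> by a flip that respects the matching, while a matched
  edge is cut with odds \<open>exp 0.625\<close>, at least \<open>3 / 2\<close>, hence with
  probability at least \<open>6 / 10\<close>.\<close>

lemma expec_val_matching:
  assumes "finite W" "finite H" "M \<subseteq> H"
    and H: "\<And>e. e \<in> H \<Longrightarrow> \<exists>u v. e = {u, v} \<and> u \<noteq> v \<and> u \<in> W \<and> v \<in> W"
    and M: "\<And>e e'. e \<in> M \<Longrightarrow> e' \<in> M \<Longrightarrow> e \<inter> e' \<noteq> {} \<Longrightarrow> e = e'"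
  defines "q \<equiv> \<lambda>S. 2.5 * real (val M S) / 4"
  shows "real (card H) / 2 + real (card M) / 10 \<le> expec (expmech (cuts W) q) (\<lambda>S. real (val H S))"
proof -
  have fin: "finite (cuts W)" "finite M" using assms by (auto simp: finite_cuts dest: finite_subset)
  have fset: "finite (set_pmf (expmech (cuts W) q))" using fin by (simp add: set_expmech cuts_nonempty)
  have unmatched: "expec (expmech (cuts W) q) (cutind e) = 1 / 2" if e: "e \<in> H - M" for e
  proof -
    obtain u v where uv: "e = {u, v}" "u \<noteq> v" "u \<in> W" "v \<in> W" using H e by blast
    \<comment> \<open>\<open>F\<close> is \<open>u\<close> together with its partner in
      \<open>M\<close>, if there is one. Flipping both preserves the score, and \<open>v\<close>
      stays outside because \<open>e\<close> is unmatched.\<close>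
    define F where "F = insert u (\<Union>{e' \<in> M. u \<in> e'})"
    have F: "e' \<subseteq> F \<or> e' \<inter> F = {}" if e': "e' \<in> M" for e'
    proof (cases "u \<in> e'")
      case False
      have "e' \<inter> e'' = {}" if "e'' \<in> M" "u \<in> e''" for e''
        using M[OF e' that(1)] that(2) False by auto
      then show ?thesis using False by (auto simp: F_def)
    qed (use e' in \<open>auto simp: F_def\<close>)
    have FW: "F \<subseteq> W" using H assms(3) uv by (fastforce simp: F_def)
    have "v \<notin> F"
    proof
      assume "v \<in> F"
      then obtain e' where e': "e' \<in> M" "u \<in> e'" "v \<in> e'" using uv by (auto simp: F_def)
      then obtain a b where "e' = {a, b}" using H assms(3) by blast
      then have "e' = e" using e' uv by auto
      then show False using e e' by auto
    qed
    then show ?thesis unfolding uv(1) using uv FW F assms(1) fin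
      by (intro expec_cutind_flip_invariant[where F = F]) (auto simp: F_def q_def val_flip_matching)
  qed
  have matched: "expec (expmech (cuts W) q) (cutind e) \<ge> 6 / 10" if e: "e \<in> M" for e
  proof -
    obtain u v where uv: "e = {u, v}" "u \<noteq> v" "u \<in> W" "v \<in> W" using H e assms(3) by blast
    \<comment> \<open>Among the matched edges the flip of \<open>u\<close> toggles only
      \<open>e\<close>, so the score moves by \<open>2.5 / 4 = 0.625\<close>. If \<open>s\<close>
      does not cut \<open>e\<close>, both sides vanish.\<close>
    have q: "exp (q (flip {u} s)) * (1 - cutind e (flip {u} s)) = exp (- 0.625) * (exp (q s) * cutind e s)"
      if s: "s \<in> cuts W" for s
    proof -
      have c: "cutind e (flip {u} s) = 1 - cutind e s"
        unfolding uv(1) using uv cutsD[OF s] by (intro cutind_flip) auto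
      have vM: "real (val M t) = cutind e t + real (val (M - {e}) t)" for t
        using fin e by (simp add: val_eq_sum sum.remove)
      have "val (M - {e}) (flip {u} s) = val (M - {e}) s"
      proof (rule val_flip_matching)
        fix e' assume "e' \<in> M - {e}"
        then show "e' \<subseteq> {u} \<or> e' \<inter> {u} = {}" using M[of e e'] e uv by auto
      qed (use fin in auto)
      then have "cutind e s = 1 \<Longrightarrow> q (flip {u} s) = - 0.625 + q s"
        by (simp add: q_def vM c field_simps)
      moreover have "cutind e s = 0 \<or> cutind e s = 1" by (simp add: cutind_def)
      ultimately show ?thesis using c by (auto simp flip: exp_add)
    qed
    let ?Z = "\<Sum>s\<in>cuts W. exp (q s)" and ?A = "\<Sum>s\<in>cuts W. exp (q s) * cutind e s"
    have Z: "?Z > 0" using fin cuts_nonempty by (simp add: sum_pos)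
    have A0: "?A \<ge> 0" by (intro sum_nonneg) (auto simp: cutind_def)
    have "?Z - ?A = (\<Sum>s\<in>cuts W. exp (q s) * (1 - cutind e s))" by (simp add: algebra_simps sum_subtractf)
    also have "\<dots> = (\<Sum>s\<in>cuts W. exp (q (flip {u} s)) * (1 - cutind e (flip {u} s)))"
      using uv by (subst sum_cuts_flip) auto
    also have "\<dots> = exp (- 0.625) * ?A" by (simp add: q sum_distrib_left)
    also have "\<dots> \<le> (2 / 3) * ?A"
    proof (intro mult_right_mono A0)
      have "(3 / 2 :: real) \<le> exp 0.625" using exp_ge_add_one_self[of "0.625"] by simp
      then show "exp (- 0.625) \<le> (2 / 3 :: real)" by (simp add: exp_minus field_simps)
    qed
    finally have "?Z * 6 / 10 \<le> ?A" by simp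
    then show ?thesis using Z by (simp add: expec_expmech fin cuts_nonempty field_simps)
  qed
  have "real (card H) / 2 + real (card M) / 10 = (\<Sum>e\<in>H. if e \<in> M then 6 / 10 else 1 / 2)"
  proof -
    have "(\<Sum>e\<in>H. if e \<in> M then 6 / 10 else 1 / 2) = (\<Sum>e\<in>H. 1 / 2 + (if e \<in> M then 1 / 10 else 0 :: real))"
      by (intro sum.cong) auto
    also have "\<dots> = real (card H) / 2 + real (card M) / 10"
      using assms(2,3) by (simp add: sum.distrib sum.If_cases Int_absorb1)
    finally show ?thesis by simp
  qed
  also have "\<dots> \<le> (\<Sum>e\<in>H. expec (expmech (cuts W) q) (cutind e))"
    using matched unmatched by (intro sum_mono) auto
  also have "\<dots> = expec (expmech (cuts W) q) (\<lambda>S. real (val H S))"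
    using assms(2) by (simp add: val_eq_sum expec_sum[OF fset])
  finally show ?thesis .
qed

section \<open>The three candidates\<close>

lemma expec_swap:
  assumes "finite (set_pmf p)" "finite (set_pmf q)"
  shows "expec p (\<lambda>x. expec q (f x)) = expec q (\<lambda>y. expec p (\<lambda>x. f x y))"
  by (simp add: integral_measure_pmf[OF assms(1)] integral_measure_pmf[OF assms(2)] sum_distrib_left
      mult_ac sum.swap[of _ "set_pmf q" "set_pmf p"])

definition side1 :: "real \<Rightarrow> nat set set \<Rightarrow> nat set \<Rightarrow> nat set \<Rightarrow> (nat \<Rightarrow> int) pmf" where
  "side1 \<epsilon> E V1 V2 =
    do {
      S1A \<leftarrow> expmech (cuts V1) (\<lambda>S. \<epsilon> * real (val {e \<in> E. e \<subseteq> V1} S) / 12);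
      S1B \<leftarrow> pmf_of_set (cuts V2);
      return_pmf (glue V1 S1A S1B)
    }"

definition subsample :: "real \<Rightarrow> nat set set \<Rightarrow> nat set set pmf" where
  "subsample r H = map_pmf (\<lambda>b. {e \<in> H. b e}) (Pi_pmf H False (\<lambda>_. bernoulli_pmf r))"

definition picks :: "nat set \<Rightarrow> nat set set \<Rightarrow> (nat \<Rightarrow> nat option) pmf" where
  "picks W H = Pi_pmf W None (\<lambda>v. if {u. {u, v} \<in> H} = {} then return_pmf None
                                 else map_pmf Some (pmf_of_set {u. {u, v} \<in> H}))"

definition matched :: "nat set set \<Rightarrow> (nat \<Rightarrow> nat option) \<Rightarrow> nat set set" where
  "matched H f = {e \<in> H. \<exists>u v. e = {u, v} \<and> f u = Some v \<and> f v = Some u}"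

definition side2 :: "real \<Rightarrow> nat set set \<Rightarrow> nat set \<Rightarrow> nat set \<Rightarrow> (nat \<Rightarrow> int) pmf" where
  "side2 r E V1 V2 =
    do {
      H \<leftarrow> subsample r {e \<in> E. e \<subseteq> V2};
      f \<leftarrow> picks V2 H;
      S2A \<leftarrow> expmech (cuts V2) (\<lambda>S. 2.5 * real (val (matched H f) S) / 4);
      S2B \<leftarrow> pmf_of_set (cuts V1);
      return_pmf (glue V2 S2A S2B)
    }"

definition select :: "real \<Rightarrow> nat set set \<Rightarrow> (nat \<Rightarrow> int) list \<Rightarrow> (nat \<Rightarrow> int) pmf" where
  "select \<epsilon> E Ss =
    do {
      i \<leftarrow> expmech {0, 1, 2 :: nat} (\<lambda>i. \<epsilon> * real (val E (Ss ! i)) / 4);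
      return_pmf (Ss ! i)
    }"

text \<open>\<open>S1B\<close> is drawn after the samples for the second candidate but independently
  of them. Commuting it forward exhibits \<open>S1\<close> and \<open>S2\<close> as independent
  draws, on which the comparison of their values relies.\<close>

lemma alg_given_V1_eq:
  "alg_given_V1 \<epsilon> \<alpha> n E V1 =
    do {
      S1 \<leftarrow> side1 \<epsilon> E V1 ({..<n} - V1);
      S2 \<leftarrow> side2 (\<epsilon> powr (1 + \<alpha>) / 70) E V1 ({..<n} - V1);
      select \<epsilon> E [S1, S2, \<lambda>v. if v \<in> V1 then 1 else -1]
    }"
  unfolding alg_given_V1_def Let_def side1_def side2_def bind_assoc_pmf bind_return_pmf
    subsample_def[symmetric] picks_def[symmetric] matched_def[symmetric] glue_def[symmetric] select_def[symmetric]
  by (rule bind_pmf_cong[OF refl], (rule trans[OF _ bind_commute_pmf], rule bind_pmf_cong[OF refl])+) (rule refl)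

lemma finite_side1: "finite V1 \<Longrightarrow> finite V2 \<Longrightarrow> finite (set_pmf (side1 \<epsilon> E V1 V2))"
  by (simp add: side1_def finite_cuts cuts_nonempty set_expmech)

lemma finite_subsample: "finite H \<Longrightarrow> finite (set_pmf (subsample r H))"
  and set_subsample: "finite H \<Longrightarrow> set_pmf (subsample r H) \<subseteq> Pow H"
  by (auto simp: subsample_def intro: finite_subset[of _ "Pow H"])

lemma finite_picks:
  assumes "finite W" "finite (\<Union>H)"
  shows "finite (set_pmf (picks W H))"
proof -
  have "finite {u. {u, v} \<in> H}" for v by (rule finite_subset[OF _ assms(2)]) auto
  then show ?thesis unfolding picks_def using assms(1)
    by (subst set_Pi_pmf) (auto intro!: finite_PiE_dflt)
qed

lemma finite_select: "finite (set_pmf (select \<epsilon> E Ss))"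
  by (simp add: select_def set_expmech)

text \<open>The loss in score is at most \<open>ln 3 \<le> 2\<close>, and the score is
  \<open>\<epsilon> / 4\<close> times the value.\<close>

lemma expec_select_ge:
  assumes "\<epsilon> > 0" "i < 3"
  shows "real (val E (Ss ! i)) - 8 / \<epsilon> \<le> expec (select \<epsilon> E Ss) (\<lambda>S. real (val E S))"
proof -
  let ?q = "\<lambda>i. \<epsilon> * real (val E (Ss ! i)) / 4"
  have i: "i \<in> {0, 1, 2}" using assms by auto
  have "ln 3 \<le> (2 :: real)" using ln_le_minus_one[of "3::real"] by simp
  then have "?q i - 2 \<le> expec (expmech {0, 1, 2 :: nat} ?q) ?q"
    using expec_expmech_ge[of "{0, 1, 2 :: nat}" i ?q] i by simp
  moreover have "expec (select \<epsilon> E Ss) (\<lambda>S. real (val E S)) = expec (expmech {0, 1, 2 :: nat} ?q) (\<lambda>i. real (val E (Ss ! i)))"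
    unfolding select_def by (subst expec_bind) (auto simp: set_expmech)
  ultimately show ?thesis using assms(1) by (simp add: field_simps)
qed

section \<open>The first candidate: mean value and spread\<close>

context
  fixes n :: nat and E :: "nat set set" and V1 V2 :: "nat set"
  assumes G: "simple_graph n E" and V12: "V1 \<union> V2 = {..<n}" "V1 \<inter> V2 = {}"
begin

lemma finite_parts: "finite E" "finite V1" "finite V2"
  using finite_simple_graph[OF G] V12 by (auto, (metis finite_Un finite_lessThan)+)

lemma expec_side1: "expec (side1 \<epsilon> E V1 V2) h
  = expec (expmech (cuts V1) (\<lambda>S. \<epsilon> * real (val {e \<in> E. e \<subseteq> V1} S) / 12)) (\<lambda>\<sigma>. avg V2 (\<lambda>s. h (glue V1 \<sigma> s)))"
  unfolding side1_def by (simp add: expec_bind set_expmech finite_cuts cuts_nonempty finite_parts expec_cuts)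

lemma expec_side1_val: "expec (side1 \<epsilon> E V1 V2) (\<lambda>S. real (val E S))
  = expec (expmech (cuts V1) (\<lambda>S. \<epsilon> * real (val {e \<in> E. e \<subseteq> V1} S) / 12))
      (\<lambda>S. real (val {e \<in> E. e \<subseteq> V1} S)) + real (card {e \<in> E. \<not> e \<subseteq> V1}) / 2"
proof -
  let ?p = "expmech (cuts V1) (\<lambda>S. \<epsilon> * real (val {e \<in> E. e \<subseteq> V1} S) / 12)"
  have s: "set_pmf ?p = cuts V1" "finite (cuts V1)" by (simp_all add: set_expmech finite_cuts cuts_nonempty finite_parts)
  have "expec (side1 \<epsilon> E V1 V2) (\<lambda>S. real (val E S))
     = expec ?p (\<lambda>\<sigma>. real (val {e \<in> E. e \<subseteq> V1} \<sigma>) + real (card {e \<in> E. \<not> e \<subseteq> V1}) / 2)"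
    unfolding expec_side1 using V12 s by (intro expec_cong avg_val_glue[OF G]) auto
  also have "\<dots> = expec ?p (\<lambda>S. real (val {e \<in> E. e \<subseteq> V1} S)) + real (card {e \<in> E. \<not> e \<subseteq> V1}) / 2"
    using s by (subst expec_add) auto
  finally show ?thesis .
qed

lemma card_edges_split: "card E = card {e \<in> E. e \<subseteq> U} + card {e \<in> E. \<not> e \<subseteq> U}"
  by (subst card_Un_disjoint[symmetric]) (auto simp: finite_parts intro: arg_cong[of _ _ card])

lemma inner_edgeE:
  assumes "e \<in> {e \<in> E. e \<subseteq> W}"
  shows "\<exists>u v. e = {u, v} \<and> u \<noteq> v \<and> u \<in> W \<and> v \<in> W"
proof -
  have "e \<in> E" "e \<subseteq> W" using assms by auto
  from \<open>e \<in> E\<close> obtain u v where "e = {u, v}" "u \<noteq> v" by (rule simple_graph_edgeE[OF G])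
  then show ?thesis using \<open>e \<subseteq> W\<close> by (intro exI[of _ u] exI[of _ v]) auto
qed

lemma expec_side1_ge_half:
  assumes "\<epsilon> > 0"
  shows "real (card E) / 2 \<le> expec (side1 \<epsilon> E V1 V2) (\<lambda>S. real (val E S))"
proof -
  let ?E = "{e \<in> E. e \<subseteq> V1}"
  let ?q = "\<lambda>S. \<epsilon> * real (val ?E S) / 12"
  have "avg V1 (\<lambda>S. real (val ?E S)) = real (card ?E) / 2"
    using finite_parts by (intro avg_val_inner inner_edgeE) auto
  then have "avg V1 ?q = \<epsilon> / 12 * (real (card ?E) / 2)" by (simp add: avg_div avg_cmult)
  moreover have "avg V1 ?q \<le> expec (expmech (cuts V1) ?q) ?q"
    using expec_expmech_ge_mean[of "cuts V1" ?q]
    by (simp add: avg_def card_cuts finite_cuts cuts_nonempty finite_parts)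
  ultimately have "\<epsilon> / 12 * (real (card ?E) / 2) \<le> \<epsilon> / 12 * expec (expmech (cuts V1) ?q) (\<lambda>S. real (val ?E S))"
    by simp
  then have "real (card ?E) / 2 \<le> expec (expmech (cuts V1) ?q) (\<lambda>S. real (val ?E S))"
    using assms by (subst (asm) mult_le_cancel_left_pos) auto
  then show ?thesis unfolding expec_side1_val using card_edges_split[of V1] by (simp add: field_simps)
qed

text \<open>Gibbs' inequality against \<open>T\<close> restricted to non-isolated vertices. Isolated
  vertices cancel from the normalised partition function; counting them would cost up to
  \<open>12 / \<epsilon>\<close> each, and their number is not bounded in terms of
  \<open>card E\<close>. On edges not inside \<open>V1\<close> the candidate gets half and
  \<open>T\<close> at most all, which explains the halved term.\<close>

lemma expec_side1_ge_cut:
  assumes "\<epsilon> > 0" and T: "T \<in> cuts {..<n}"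
  shows "real (val E T) - (real (card E) - real (card {e \<in> E. e \<subseteq> V1})) / 2
           - 12 / \<epsilon> * real (card {v \<in> V1. 1 \<le> degree E v})
      \<le> expec (side1 \<epsilon> E V1 V2) (\<lambda>S. real (val E S))"
proof -
  let ?E = "{e \<in> E. e \<subseteq> V1}" and ?N = "{v \<in> V1. 1 \<le> degree E v}"
  let ?q = "\<lambda>S. \<epsilon> * real (val ?E S) / 12"
  have nonisolated: "x \<in> ?N" if "e \<in> ?E" "x \<in> e" for e x
  proof -
    have "e \<in> {e \<in> E. x \<in> e}" using that by auto
    then have "card {e \<in> E. x \<in> e} > 0" using finite_parts by (auto simp: card_gt_0_iff)
    then show ?thesis using that by (auto simp: degree_def)
  qed
  have val_cong: "val ?E S = val ?E S'" if "\<And>x. x \<in> ?N \<Longrightarrow> S x = S' x" for S S'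
  proof -
    have "real (val ?E S) = real (val ?E S')"
      using finite_parts that nonisolated by (auto simp: val_eq_sum intro!: sum.cong cutind_cong)
    then show ?thesis by simp
  qed
  let ?T = "restrict T ?N"
  have TN: "?T \<in> cuts ?N" using T V12 by (auto simp: cuts_def)
  have "avg ((V1 - ?N) \<union> ?N) (\<lambda>S. exp (?q S)) = avg ?N (\<lambda>S. exp (?q S))"
  proof (rule avg_superset)
    fix s x y assume "x \<in> V1 - ?N"
    then have "val ?E (s(x := y)) = val ?E s" by (intro val_cong) auto
    then show "exp (?q (s(x := y))) = exp (?q s)" by simp
  qed (use finite_parts in auto)
  moreover have "(V1 - ?N) \<union> ?N = V1" by auto
  ultimately have avgN: "avg V1 (\<lambda>S. exp (?q S)) = avg ?N (\<lambda>S. exp (?q S))" by simp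
  have "exp (?q ?T) / 2 ^ card ?N \<le> avg ?N (\<lambda>S. exp (?q S))"
    unfolding avg_def using finite_parts
    by (intro divide_right_mono member_le_sum[OF TN, of "\<lambda>S. exp (?q S)"]) (auto simp: finite_cuts)
  then have "ln (exp (?q ?T) / 2 ^ card ?N) \<le> ln (avg V1 (\<lambda>S. exp (?q S)))"
    unfolding avgN by (intro ln_mono) auto
  also have "\<dots> \<le> expec (expmech (cuts V1) ?q) ?q"
    using expec_expmech_ge_ln_mean[of "cuts V1" ?q]
    by (simp add: avg_def card_cuts finite_cuts cuts_nonempty finite_parts)
  also have "ln (exp (?q ?T) / 2 ^ card ?N) = ?q T - card ?N * ln 2"
    using val_cong[of ?T T] by (simp add: ln_div ln_realpow)
  finally have "?q T - card ?N * ln 2 \<le> expec (expmech (cuts V1) ?q) ?q" .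
  moreover have "ln 2 \<le> (1::real)" using ln_le_minus_one[of "2::real"] by simp
  then have "card ?N * ln 2 \<le> card ?N * (1 :: real)" by (intro mult_left_mono) auto
  ultimately have "?q T - card ?N \<le> \<epsilon> * expec (expmech (cuts V1) ?q) (\<lambda>S. real (val ?E S)) / 12" by simp
  then have "real (val ?E T) - 12 / \<epsilon> * card ?N \<le> expec (expmech (cuts V1) ?q) (\<lambda>S. real (val ?E S))"
    using assms by (simp add: field_simps)
  moreover have "real (val E T) \<le> real (val ?E T) + real (card {e \<in> E. \<not> e \<subseteq> V1})"
  proof -
    have "real (val E T) = (\<Sum>e\<in>E. cutind e T)" using finite_parts by (simp add: val_eq_sum)
    also have "\<dots> \<le> (\<Sum>e\<in>E. if e \<subseteq> V1 then cutind e T else 1)"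
      by (intro sum_mono) (auto simp: cutind_def)
    also have "\<dots> = real (val ?E T) + real (card {e \<in> E. \<not> e \<subseteq> V1})"
    proof -
      have "E \<inter> {e. e \<subseteq> V1} = ?E" "E \<inter> - {e. e \<subseteq> V1} = {e \<in> E. \<not> e \<subseteq> V1}" by auto
      then show ?thesis using finite_parts by (simp add: sum.If_cases val_eq_sum)
    qed
    finally show ?thesis .
  qed
  ultimately show ?thesis unfolding expec_side1_val using card_edges_split[of V1] by (simp add: field_simps)
qed

lemma expec_side1_abs:
  "sqrt (real (card {e \<in> E. e \<subseteq> V2}) / 108) \<le> expec (side1 \<epsilon> E V1 V2) (\<lambda>S. \<bar>real (val E S) - t\<bar>)"
  unfolding expec_side1 using finite_parts V12
  by (intro expec_ge_const avg_abs_val_glue_ge[OF G]) (auto simp: set_expmech finite_cuts cuts_nonempty)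

end

section \<open>The second candidate: isolated edges of the subsample and the random matching\<close>

lemma expec_of_bool:
  "expec p (\<lambda>x. of_bool (P x)) = measure_pmf.prob p {x. P x}"
proof -
  have "expec p (\<lambda>x. of_bool (P x)) = expec p (indicator {x. P x})"
    by (intro arg_cong[where f = "expec p"]) (auto simp: indicator_def)
  then show ?thesis by simp
qed

text \<open>The event prescribes independent coordinates: \<open>e\<close> present, all of
  \<open>H \<inter> K\<close> absent. Bernoulli's inequality linearises the resulting power of
  \<open>1 - r\<close>.\<close>

lemma prob_subsample_isolated:
  fixes r :: real
  assumes "finite H" "e \<in> H" "e \<notin> K" "0 \<le> r" "r \<le> 1"
  shows "r * (1 - card (H \<inter> K) * r) \<le> expec (subsample r H) (\<lambda>H'. of_bool (e \<in> H' \<and> H' \<inter> K = {}))"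
proof -
  let ?B = "\<lambda>x. if x = e then {True} else if x \<in> K then {False} else UNIV"
  let ?P = "Pi_pmf H False (\<lambda>_. bernoulli_pmf r)"
  have "expec (subsample r H) (\<lambda>H'. of_bool (e \<in> H' \<and> H' \<inter> K = {}))
     = measure_pmf.prob ?P {b. e \<in> {e \<in> H. b e} \<and> {e \<in> H. b e} \<inter> K = {}}"
    unfolding subsample_def by (simp add: expec_of_bool)
  also have "{b. e \<in> {e \<in> H. b e} \<and> {e \<in> H. b e} \<inter> K = {}} = Pi H ?B"
    using assms by (auto simp: Pi_iff split: if_splits)
  also have "measure_pmf.prob ?P (Pi H ?B) = (\<Prod>x\<in>H. measure_pmf.prob (bernoulli_pmf r) (?B x))"
    by (rule measure_Pi_pmf_Pi[OF assms(1)])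
  also have "\<dots> = (\<Prod>x\<in>H. if x = e then r else if x \<in> K then 1 - r else 1)"
    using assms by (intro prod.cong) (auto simp: measure_pmf_single)
  also have "\<dots> = r * (\<Prod>x\<in>H - {e}. if x \<in> K then 1 - r else 1)"
    using assms by (subst prod.remove[of _ e]) (auto intro!: prod.cong)
  also have "(\<Prod>x\<in>H - {e}. if x \<in> K then 1 - r else 1) = (1 - r) ^ card ((H - {e}) \<inter> K)"
    using assms by (simp add: prod.If_cases)
  also have "(H - {e}) \<inter> K = H \<inter> K" using assms by auto
  finally have "expec (subsample r H) (\<lambda>H'. of_bool (e \<in> H' \<and> H' \<inter> K = {})) = r * (1 - r) ^ card (H \<inter> K)" .
  moreover have "1 + card (H \<inter> K) * (- r) \<le> (1 + - r) ^ card (H \<inter> K)"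
    using assms by (intro Bernoulli_inequality) auto
  ultimately show ?thesis using assms by (auto intro: mult_left_mono)
qed

text \<open>Each endpoint has the other as its only neighbour, so both picks are forced. Restricting
  attention to such edges avoids any analysis of the randomness in \<open>picks\<close>.\<close>

lemma isolated_edge_matched:
  assumes "finite W" "{u, v} \<in> H" "u \<in> W" "v \<in> W" "u \<noteq> v"
    and iso: "\<And>e. e \<in> H \<Longrightarrow> e \<inter> {u, v} \<noteq> {} \<Longrightarrow> e = {u, v}"
    and f: "f \<in> set_pmf (picks W H)"
  shows "{u, v} \<in> matched H f"
proof -
  have f': "f x \<in> set_pmf (if {w. {w, x} \<in> H} = {} then return_pmf None
      else map_pmf Some (pmf_of_set {w. {w, x} \<in> H}))" if "x \<in> W" for x
    using f that assms(1) unfolding picks_def by (auto simp: set_Pi_pmf PiE_dflt_def)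
  have nu: "{w. {w, u} \<in> H} = {v}"
  proof (intro set_eqI iffI)
    fix w assume "w \<in> {w. {w, u} \<in> H}"
    then have "{w, u} = {u, v}" by (intro iso) auto
    then show "w \<in> {v}" using assms(5) by (auto simp: doubleton_eq_iff)
  qed (use assms(2) in \<open>simp add: insert_commute\<close>)
  have nv: "{w. {w, v} \<in> H} = {u}"
  proof (intro set_eqI iffI)
    fix w assume "w \<in> {w. {w, v} \<in> H}"
    then have "{w, v} = {u, v}" by (intro iso) auto
    then show "w \<in> {u}" using assms(5) by (auto simp: doubleton_eq_iff)
  qed (use assms(2) in \<open>simp add: insert_commute\<close>)
  have "f u = Some v" "f v = Some u"
    using f'[OF assms(3), unfolded nu] f'[OF assms(4), unfolded nv] by simp_all
  then show ?thesis using assms(2) unfolding matched_def by auto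
qed

context
  fixes n :: nat and E :: "nat set set" and V1 V2 :: "nat set"
  assumes G: "simple_graph n E" and V12: "V1 \<union> V2 = {..<n}" "V1 \<inter> V2 = {}"
begin

lemma finite_Union_inner: "H \<subseteq> {e \<in> E. e \<subseteq> V2} \<Longrightarrow> finite (\<Union>H)"
  using V12 by (auto intro!: finite_subset[of _ "{..<n}"])

text \<open>A shared vertex \<open>x\<close> determines its partner through \<open>f x\<close>,
  hence the whole edge.\<close>

lemma matched_disjoint:
  assumes "e \<in> matched H f" "e' \<in> matched H f" "e \<inter> e' \<noteq> {}"
  shows "e = e'"
  using assms by (fastforce simp: matched_def doubleton_eq_iff)

text \<open>The matching lives in the subsample, but the value counts all edges of the graph: each
  has base rate at least \<open>1 / 2\<close>, and the matched ones earn a further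
  \<open>1 / 10\<close>.\<close>

lemma expec_side2_ge:
  "real (card E) / 2 + expec (subsample r {e \<in> E. e \<subseteq> V2}) (\<lambda>H. expec (picks V2 H) (\<lambda>f. real (card (matched H f)))) / 10
    \<le> expec (side2 r E V1 V2) (\<lambda>S. real (val E S))"
proof -
  let ?E = "{e \<in> E. e \<subseteq> V2}"
  let ?q = "\<lambda>H f S. 2.5 * real (val (matched H f) S) / 4"
  note fin = finite_parts[OF G V12]
  have finE: "finite ?E" using fin by simp
  have fins: "finite (set_pmf (subsample r ?E))" using finE by (rule finite_subsample)
  have Hsub: "H \<subseteq> ?E" if "H \<in> set_pmf (subsample r ?E)" for H using set_subsample[OF finE] that by blast
  have finp: "finite (set_pmf (picks V2 H))" if "H \<in> set_pmf (subsample r ?E)" for H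
    using fin finite_Union_inner[OF Hsub[OF that]] by (intro finite_picks) auto
  have se: "set_pmf (expmech (cuts V2) q) = cuts V2" "finite (cuts V2)" for q
    by (simp_all add: set_expmech finite_cuts cuts_nonempty fin)
  have inner: "real (card E) / 2 + real (card (matched H f)) / 10
      \<le> expec (expmech (cuts V2) (?q H f)) (\<lambda>\<sigma>. avg V1 (\<lambda>s. real (val E (glue V2 \<sigma> s))))"
    if H: "H \<in> set_pmf (subsample r ?E)" for H f
  proof -
    have "expec (expmech (cuts V2) (?q H f)) (\<lambda>\<sigma>. avg V1 (\<lambda>s. real (val E (glue V2 \<sigma> s))))
      = expec (expmech (cuts V2) (?q H f)) (\<lambda>\<sigma>. real (val ?E \<sigma>) + real (card {e \<in> E. \<not> e \<subseteq> V2}) / 2)"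
      using V12 se by (intro expec_cong avg_val_glue[OF G]) auto
    also have "\<dots> = expec (expmech (cuts V2) (?q H f)) (\<lambda>\<sigma>. real (val ?E \<sigma>)) + real (card {e \<in> E. \<not> e \<subseteq> V2}) / 2"
      using se by (subst expec_add) auto
    also have "\<dots> \<ge> real (card ?E) / 2 + real (card (matched H f)) / 10 + real (card {e \<in> E. \<not> e \<subseteq> V2}) / 2"
    proof (intro add_right_mono expec_val_matching inner_edgeE[OF G V12] finE)
      show "matched H f \<subseteq> ?E" using Hsub[OF H] by (auto simp: matched_def)
    qed (use fin matched_disjoint in auto)
    finally show ?thesis using card_edges_split[OF G V12, of V2] by (simp add: add_divide_distrib)
  qed
  have "real (card E) / 2 + expec (subsample r ?E) (\<lambda>H. expec (picks V2 H) (\<lambda>f. real (card (matched H f)))) / 10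
    = expec (subsample r ?E) (\<lambda>H. real (card E) / 2 + expec (picks V2 H) (\<lambda>f. real (card (matched H f))) / 10)"
    by (subst expec_add[OF fins]) auto
  also have "\<dots> = expec (subsample r ?E) (\<lambda>H. expec (picks V2 H) (\<lambda>f. real (card E) / 2 + real (card (matched H f)) / 10))"
    by (intro expec_cong, subst expec_add) (auto intro: finp)
  also have "\<dots> \<le> expec (subsample r ?E) (\<lambda>H. expec (picks V2 H) (\<lambda>f.
       expec (expmech (cuts V2) (?q H f)) (\<lambda>\<sigma>. avg V1 (\<lambda>s. real (val E (glue V2 \<sigma> s))))))"
    by (intro expec_mono fins finp inner) auto
  also have "\<dots> = expec (side2 r E V1 V2) (\<lambda>S. real (val E S))"
    unfolding side2_def using fin se fins finp
    by (simp add: expec_bind cuts_nonempty finite_cuts expec_cuts cong: expec_cong)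
  finally show ?thesis .
qed

text \<open>Only edges isolated in the subsample are counted. An edge with both degrees at most
  \<open>D\<close> meets at most \<open>2 * D\<close> others, so it survives alone with probability
  at least \<open>r * (1 - 2 * D * r)\<close>, and \<open>1 - 6 / 7 = 1 / 7\<close>.\<close>

lemma expec_matched_ge:
  assumes r: "0 \<le> r" "r \<le> 1" and D: "2 * D * r \<le> 6 / 7"
  shows "r / 7 * real (card {e \<in> E. e \<subseteq> V2 \<and> (\<forall>u\<in>e. real (degree E u) \<le> D)})
    \<le> expec (subsample r {e \<in> E. e \<subseteq> V2}) (\<lambda>H. expec (picks V2 H) (\<lambda>f. real (card (matched H f))))"
proof -
  let ?E = "{e \<in> E. e \<subseteq> V2}" and ?L = "{e \<in> E. e \<subseteq> V2 \<and> (\<forall>u\<in>e. real (degree E u) \<le> D)}"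
  let ?K = "\<lambda>e. {e'. e' \<noteq> e \<and> e' \<inter> e \<noteq> {}}"
  note fin = finite_parts[OF G V12]
  have finE: "finite ?E" "finite ?L" using fin by simp_all
  have fins: "finite (set_pmf (subsample r ?E))" using finE(1) by (rule finite_subsample)
  have Hsub: "H \<subseteq> ?E" if "H \<in> set_pmf (subsample r ?E)" for H using set_subsample[OF finE(1)] that by blast
  have finp: "finite (set_pmf (picks V2 H))" if "H \<in> set_pmf (subsample r ?E)" for H
    using fin finite_Union_inner[OF Hsub[OF that]] by (intro finite_picks) auto
  have "r / 7 * real (card ?L) = (\<Sum>e\<in>?L. r / 7)" by simp
  also have "\<dots> \<le> (\<Sum>e\<in>?L. expec (subsample r ?E) (\<lambda>H. of_bool (e \<in> H \<and> H \<inter> ?K e = {})))"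
  proof (intro sum_mono)
    fix e assume e: "e \<in> ?L"
    then obtain u v where uv: "e = {u, v}" using G by (auto elim: simple_graph_edgeE)
    have "card (?E \<inter> ?K e) \<le> card ({e \<in> E. u \<in> e} \<union> {e \<in> E. v \<in> e})"
      using fin uv by (intro card_mono) auto
    also have "\<dots> \<le> degree E u + degree E v" unfolding degree_def by (rule card_Un_le)
    finally have "real (card (?E \<inter> ?K e)) \<le> 2 * D" using e uv by simp
    then have "real (card (?E \<inter> ?K e)) * r \<le> 2 * D * r" using r by (intro mult_right_mono)
    then have "1 / 7 \<le> 1 - real (card (?E \<inter> ?K e)) * r" using D by simp
    then have "r * (1 / 7) \<le> r * (1 - real (card (?E \<inter> ?K e)) * r)" using r by (intro mult_left_mono)
    also have "\<dots> \<le> expec (subsample r ?E) (\<lambda>H. of_bool (e \<in> H \<and> H \<inter> ?K e = {}))"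
      using e r finE by (intro prob_subsample_isolated) auto
    finally show "r / 7 \<le> expec (subsample r ?E) (\<lambda>H. of_bool (e \<in> H \<and> H \<inter> ?K e = {}))" by simp
  qed
  also have "\<dots> = expec (subsample r ?E) (\<lambda>H. \<Sum>e\<in>?L. of_bool (e \<in> H \<and> H \<inter> ?K e = {}))"
    by (rule expec_sum[OF fins, symmetric])
  also have "\<dots> \<le> expec (subsample r ?E) (\<lambda>H. expec (picks V2 H) (\<lambda>f. real (card (matched H f))))"
  proof (intro expec_mono fins expec_ge_const finp)
    fix H f assume H: "H \<in> set_pmf (subsample r ?E)" and f: "f \<in> set_pmf (picks V2 H)"
    have finH: "finite H" using Hsub[OF H] finE by (auto dest: finite_subset)
    have "(\<Sum>e\<in>?L. of_bool (e \<in> H \<and> H \<inter> ?K e = {})) = real (card (?L \<inter> {e. e \<in> H \<and> H \<inter> ?K e = {}}))"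
      using finE by (simp add: of_bool_def sum.If_cases)
    also have "\<dots> \<le> real (card (matched H f))"
    proof (intro of_nat_mono card_mono)
      show "finite (matched H f)" using finH by (simp add: matched_def)
      show "?L \<inter> {e. e \<in> H \<and> H \<inter> ?K e = {}} \<subseteq> matched H f"
      proof
        fix e assume e: "e \<in> ?L \<inter> {e. e \<in> H \<and> H \<inter> ?K e = {}}"
        then have "e \<in> {e \<in> E. e \<subseteq> V2}" by auto
        then obtain u v where uv: "e = {u, v}" "u \<noteq> v" "u \<in> V2" "v \<in> V2"
          using inner_edgeE[OF G V12] by blast
        show "e \<in> matched H f" unfolding uv(1)
        proof (rule isolated_edge_matched[OF _ _ _ _ _ _ f])
          fix e' assume "e' \<in> H" "e' \<inter> {u, v} \<noteq> {}"
          then show "e' = {u, v}" using e uv by auto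
        qed (use e uv fin in auto)
      qed
    qed
    finally show "(\<Sum>e\<in>?L. of_bool (e \<in> H \<and> H \<inter> ?K e = {})) \<le> real (card (matched H f))" .
  qed auto
  finally show ?thesis .
qed

lemma finite_side2: "finite (set_pmf (side2 r E V1 V2))"
proof -
  note fin = finite_parts[OF G V12]
  have finE: "finite {e \<in> E. e \<subseteq> V2}" using fin by simp
  have "finite (set_pmf (picks V2 H))" if "H \<in> set_pmf (subsample r {e \<in> E. e \<subseteq> V2})" for H
    using that set_subsample[OF finE] fin by (intro finite_picks finite_Union_inner) auto
  then show ?thesis using fin finite_subsample[OF finE]
    by (simp add: side2_def set_expmech finite_cuts cuts_nonempty)
qed

end

section \<open>The bound conditional on the degree partition\<close>

text \<open>The exceptional quantities \<open>H\<close> and \<open>N\<close> enter linearly, so that the bound survives taking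
  expectations over the noise.\<close>

lemma pointwise_arith:
  fixes m e1 e2 H N F p \<epsilon> :: real
  assumes "0 < \<epsilon>" "\<epsilon> \<le> 1" "0 \<le> p" "p \<le> 1" "m * \<epsilon>\<^sup>2 \<ge> 1000000000" "0 \<le> H" "0 \<le> N"
    and balanced: "m / 2 + p / 9800 * (e2 - H) + (sqrt (e2 / 108) / 2 - 8 / \<epsilon>) \<le> F"
    and crossing: "m - e1 - e2 - 8 / \<epsilon> \<le> F"
    and half: "m / 2 - 8 / \<epsilon> \<le> F"
    and inner: "9 / 10 * m - (m - e1) / 2 - 12 / \<epsilon> * N - 8 / \<epsilon> \<le> F"
  shows "m / 2 + p / 9800 * (9 / 100 * m - H) - (8 / \<epsilon> + p / 9800 * (9 / 100 * m)) * (240 * N / (\<epsilon> * m)) \<le> F"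
proof -
  define g where "g = p / 9800"
  define k where "k = 240 * N / (\<epsilon> * m)"
  define K where "K = 8 / \<epsilon>"
  define a where "a = 12 / \<epsilon> * N"
  have "0 < m * \<epsilon>\<^sup>2" using assms(5) by linarith
  then have m: "m > 0" using assms(1) by (auto simp: zero_less_mult_iff)
  have g: "0 \<le> g" "g \<le> 1 / 9800" using assms by (auto simp: g_def)
  have K0: "K \<ge> 0" using assms by (simp add: K_def)
  have k0: "k \<ge> 0" using assms m by (simp add: k_def)
  have gm: "0 \<le> g * m" "g * m \<le> m / 9800" using g m mult_right_mono[of g "1 / 9800" m] by auto
  have gH: "0 \<le> g * H" using g assms by simp
  have loss: "(K + g * (9 / 100 * m)) * k \<ge> 0" using K0 gm k0 by simp
  have "\<epsilon>\<^sup>2 \<le> \<epsilon>" using assms by (simp add: power2_eq_square mult_left_le)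
  then have "m * \<epsilon>\<^sup>2 \<le> m * \<epsilon>" using m by (intro mult_left_mono) auto
  then have K: "K \<le> 1 / 1000 * m" using assms by (simp add: K_def field_simps)
  \<comment> \<open>In the second case the crossing edges alone beat \<open>m / 2\<close> by
    \<open>m / 100\<close>; in the third, \<open>1 - 9 / 100 - 51 / 100\<close> leaves more than
    \<open>4 / 10 * m\<close> edges inside \<open>V1\<close>.\<close>
  consider "e2 \<ge> 9 / 100 * m" | "e2 < 9 / 100 * m" "m - e1 - e2 \<ge> 51 / 100 * m" | "e2 < 9 / 100 * m" "m - e1 - e2 < 51 / 100 * m"
    by linarith
  then have "m / 2 + g * (9 / 100 * m - H) - (K + g * (9 / 100 * m)) * k \<le> F"
  proof cases
    case 1
    \<comment> \<open>The spread term \<open>sqrt (e2 / 108) / 2\<close> has to reach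
      \<open>8 / \<epsilon>\<close>, which amounts to
      \<open>e2 \<ge> 108 * 256 / \<epsilon>\<^sup>2\<close>.\<close>
    have "(16 / \<epsilon>)\<^sup>2 \<le> e2 / 108"
    proof -
      have "256 * 108 \<le> 9 / 100 * (m * \<epsilon>\<^sup>2)" using assms(5) by simp
      also have "\<dots> \<le> e2 * \<epsilon>\<^sup>2" using mult_right_mono[OF 1, of "\<epsilon>\<^sup>2"] by (simp add: mult.assoc)
      finally show ?thesis using assms(1) by (simp add: power_divide field_simps)
    qed
    then have "16 / \<epsilon> \<le> sqrt (e2 / 108)" by (rule real_le_rsqrt)
    moreover have "g * (9 / 100 * m - H) \<le> g * (e2 - H)" using 1 g by (intro mult_left_mono) auto
    ultimately show ?thesis using balanced loss unfolding g_def[symmetric] by linarith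
  next
    case 2
    then show ?thesis using crossing K K0 gm gH loss unfolding K_def[symmetric] by (simp add: algebra_simps)
  next
    case 3
    then have e1: "e1 > 4 / 10 * m" by linarith
    \<comment> \<open>\<open>k\<close> is normalised so that \<open>k \<le> 1\<close> means
      \<open>a \<le> m / 20\<close>, a loss that \<open>inner\<close> can afford. For
      \<open>k > 1\<close> the charge already exceeds both the gain and \<open>K\<close>, so
      \<open>half\<close> suffices; this is how the indicator of a bad event is replaced by a linear
      term.\<close>
    show ?thesis
    proof (cases "k \<le> 1")
      case True
      then have "a \<le> m / 20" using m assms(1) by (simp add: a_def k_def field_simps)
      then have "55 / 100 * m - K \<le> F" using inner e1 unfolding K_def[symmetric] a_def[symmetric] by argo
      then show ?thesis using K gm gH loss unfolding right_diff_distrib by linarith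
    next
      case False
      then have "(K + g * (9 / 100 * m)) * 1 \<le> (K + g * (9 / 100 * m)) * k"
        using K0 gm by (intro mult_left_mono) auto
      then show ?thesis using half gH unfolding K_def[symmetric] by (simp add: algebra_simps)
    qed
  qed
  then show ?thesis by (simp add: g_def k_def K_def)
qed

context
  fixes n :: nat and E :: "nat set set" and V1 :: "nat set" and \<epsilon> \<alpha> :: real
  assumes G: "simple_graph n E" and V1n: "V1 \<subseteq> {..<n}" and eps: "\<epsilon> > 0"
begin

private abbreviation (input) "V2 \<equiv> {..<n} - V1"
private abbreviation (input) "p \<equiv> \<epsilon> powr (1 + \<alpha>)"
private abbreviation (input) "p1 \<equiv> side1 \<epsilon> E V1 V2"
private abbreviation (input) "p2 \<equiv> side2 (p / 70) E V1 V2"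
private abbreviation (input) "out \<equiv> expec (alg_given_V1 \<epsilon> \<alpha> n E V1) (\<lambda>S. real (val E S))"
private abbreviation (input) "v \<equiv> \<lambda>S. real (val E S)"

lemma complement_partition: "V1 \<union> V2 = {..<n}" "V1 \<inter> V2 = {}"
  using V1n by auto

lemma finite_sides: "finite (set_pmf p1)" "finite (set_pmf p2)"
  using finite_parts[OF G complement_partition] finite_side1 finite_side2[OF G complement_partition] by auto

lemma expec_alg: "out = expec p1 (\<lambda>S1. expec p2 (\<lambda>S2.
    expec (select \<epsilon> E [S1, S2, \<lambda>v. if v \<in> V1 then 1 else -1]) v))"
  unfolding alg_given_V1_eq using finite_sides by (simp add: expec_bind finite_select)

lemma expec_select3_ge:
  "v S1 - 8 / \<epsilon> \<le> expec (select \<epsilon> E [S1, S2, S3]) v"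
  "v S2 - 8 / \<epsilon> \<le> expec (select \<epsilon> E [S1, S2, S3]) v"
  "v S3 - 8 / \<epsilon> \<le> expec (select \<epsilon> E [S1, S2, S3]) v"
  using expec_select_ge[OF eps, of 0 E "[S1, S2, S3]"] expec_select_ge[OF eps, of 1 E "[S1, S2, S3]"]
    expec_select_ge[OF eps, of 2 E "[S1, S2, S3]"] by simp_all

lemma expec_alg_ge_side1: "expec p1 v - 8 / \<epsilon> \<le> out"
proof -
  have "expec p1 v - 8 / \<epsilon> = expec p1 (\<lambda>S1. v S1 - 8 / \<epsilon>)" using finite_sides by (simp add: expec_diff)
  also have "\<dots> \<le> out" unfolding expec_alg
    by (rule expec_mono[OF finite_sides(1)], rule expec_ge_const[OF finite_sides(2)]) (rule expec_select3_ge)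
  finally show ?thesis .
qed

lemma expec_alg_ge_crossing:
  "real (card E) - real (card {e \<in> E. e \<subseteq> V1}) - real (card {e \<in> E. e \<subseteq> V2}) - 8 / \<epsilon> \<le> out"
proof -
  let ?S3 = "\<lambda>v. if v \<in> V1 then 1 else (-1 :: int)"
  note fin = finite_parts[OF G complement_partition]
  have "E = {e \<in> E. \<not> e \<subseteq> V1 \<and> \<not> e \<subseteq> V2} \<union> ({e \<in> E. e \<subseteq> V1} \<union> {e \<in> E. e \<subseteq> V2})" by auto
  then have "card E \<le> card {e \<in> E. \<not> e \<subseteq> V1 \<and> \<not> e \<subseteq> V2} + (card {e \<in> E. e \<subseteq> V1} + card {e \<in> E. e \<subseteq> V2})"
    by (metis (no_types, lifting) card_Un_le add_left_mono order_trans)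
  moreover have "{e \<in> E. \<not> e \<subseteq> V1 \<and> \<not> e \<subseteq> V2} \<subseteq> {e \<in> E. \<exists>u v. e = {u, v} \<and> ?S3 u \<noteq> ?S3 v}"
  proof
    fix e assume e: "e \<in> {e \<in> E. \<not> e \<subseteq> V1 \<and> \<not> e \<subseteq> V2}"
    then have "e \<in> E" by simp
    then obtain u v where uv: "e = {u, v}" "u < n" "v < n" by (rule simple_graph_edgeE[OF G])
    then have "?S3 u \<noteq> ?S3 v" using e by auto
    then show "e \<in> {e \<in> E. \<exists>u v. e = {u, v} \<and> ?S3 u \<noteq> ?S3 v}" using e uv by blast
  qed
  then have "card {e \<in> E. \<not> e \<subseteq> V1 \<and> \<not> e \<subseteq> V2} \<le> val E ?S3"
    unfolding val_def using fin by (intro card_mono) auto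
  ultimately have "real (card E) - real (card {e \<in> E. e \<subseteq> V1}) - real (card {e \<in> E. e \<subseteq> V2}) \<le> v ?S3"
    by linarith
  moreover have "v ?S3 - 8 / \<epsilon> \<le> out" unfolding expec_alg
    by (rule expec_ge_const[OF finite_sides(1)], rule expec_ge_const[OF finite_sides(2)]) (rule expec_select3_ge)
  ultimately show ?thesis by linarith
qed

text \<open>The spread of \<open>val E S1\<close> around \<open>val E S2\<close> pays for the additive loss \<open>8 / \<epsilon>\<close> of the selection
  step, because \<open>max a b = (a + b) / 2 + \<bar>a - b\<bar> / 2\<close>.\<close>

lemma expec_alg_ge_balanced:
  "(expec p1 v + expec p2 v) / 2 + sqrt (real (card {e \<in> E. e \<subseteq> V2}) / 108) / 2 - 8 / \<epsilon> \<le> out"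
proof -
  have "sqrt (real (card {e \<in> E. e \<subseteq> V2}) / 108) \<le> expec p2 (\<lambda>S2. expec p1 (\<lambda>S1. \<bar>v S1 - v S2\<bar>))"
    using finite_sides by (intro expec_ge_const expec_side1_abs[OF G complement_partition])
  also have "\<dots> = expec p1 (\<lambda>S1. expec p2 (\<lambda>S2. \<bar>v S1 - v S2\<bar>))"
    by (rule expec_swap[OF finite_sides(2,1)])
  finally have "(expec p1 v + expec p2 v) / 2 + sqrt (real (card {e \<in> E. e \<subseteq> V2}) / 108) / 2 - 8 / \<epsilon>
    \<le> (expec p1 v + expec p2 v) / 2 + expec p1 (\<lambda>S1. expec p2 (\<lambda>S2. \<bar>v S1 - v S2\<bar>)) / 2 - 8 / \<epsilon>" by simp
  also have "\<dots> = expec p1 (\<lambda>S1. expec p2 (\<lambda>S2. (v S1 + v S2) / 2 + \<bar>v S1 - v S2\<bar> / 2 - 8 / \<epsilon>))"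
    using finite_sides by (simp add: expec_diff expec_add add_divide_distrib)
  also have "\<dots> \<le> out" unfolding expec_alg
  proof (intro expec_mono finite_sides)
    fix S1 S2
    show "(v S1 + v S2) / 2 + \<bar>v S1 - v S2\<bar> / 2 - 8 / \<epsilon>
        \<le> expec (select \<epsilon> E [S1, S2, \<lambda>v. if v \<in> V1 then 1 else -1]) v"
      using expec_select3_ge(1,2)[where ?S1.0 = S1 and ?S2.0 = S2 and ?S3.0 = "\<lambda>v. if v \<in> V1 then 1 else -1"]
      by (auto simp: abs_if field_simps)
  qed
  finally show ?thesis .
qed

lemma expec_alg_ge_half: "real (card E) / 2 - 8 / \<epsilon> \<le> out"
  using expec_alg_ge_side1 expec_side1_ge_half[OF G complement_partition eps] by linarith

text \<open>Origin of the constants: with rate \<open>p / 70\<close> and degrees up to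
  \<open>30 / p\<close>, \<open>2 * 30 / 70 = 6 / 7\<close>, so an edge is matched with probability
  at least \<open>p / 490\<close>. A matched edge earns \<open>1 / 10\<close>, giving
  \<open>p / 4900\<close>, and averaging with \<open>S1\<close> halves this to
  \<open>p / 9800\<close>. The cutoff \<open>30 / p\<close> lies above the threshold
  \<open>24 / p\<close>, so vertices beyond it rarely land in \<open>V2\<close>.\<close>

lemma expec_alg_ge:
  assumes "\<epsilon> \<le> 1" "p \<le> 1" "real (card E) * \<epsilon>\<^sup>2 \<ge> 1000000000"
    and T: "T \<in> cuts {..<n}" "9 / 10 * real (card E) \<le> real (val E T)"
  shows "real (card E) / 2
      + p / 9800 * (9 / 100 * real (card E) - real (card {e \<in> E. e \<subseteq> V2 \<and> (\<exists>u\<in>e. 30 / p < real (degree E u))}))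
      - (8 / \<epsilon> + p / 9800 * (9 / 100 * real (card E)))
          * (240 * real (card {v \<in> V1. 1 \<le> degree E v}) / (\<epsilon> * real (card E))) \<le> out"
proof (rule pointwise_arith)
  let ?Hi = "{e \<in> E. e \<subseteq> V2 \<and> (\<exists>u\<in>e. 30 / p < real (degree E u))}"
  let ?Lo = "{e \<in> E. e \<subseteq> V2 \<and> (\<forall>u\<in>e. real (degree E u) \<le> 30 / p)}"
  note fin = finite_parts[OF G complement_partition]
  have p: "p > 0" using eps by simp
  have "{e \<in> E. e \<subseteq> V2} = ?Hi \<union> ?Lo" by (auto simp: not_less not_le)
  moreover have "?Hi \<inter> ?Lo = {}" by (force simp: not_less)
  ultimately have "card {e \<in> E. e \<subseteq> V2} = card ?Hi + card ?Lo"
    using fin by (simp add: card_Un_disjoint)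
  moreover have "p / 70 / 7 * real (card ?Lo)
    \<le> expec (subsample (p / 70) {e \<in> E. e \<subseteq> V2}) (\<lambda>H. expec (picks V2 H) (\<lambda>f. real (card (matched H f))))"
    using p assms(2) by (intro expec_matched_ge[OF G complement_partition]) auto
  ultimately have "real (card E) / 2 + p / 4900 * (real (card {e \<in> E. e \<subseteq> V2}) - real (card ?Hi)) \<le> expec p2 v"
    using expec_side2_ge[OF G complement_partition, of "p / 70"] by simp
  then show "real (card E) / 2 + p / 9800 * (real (card {e \<in> E. e \<subseteq> V2}) - real (card ?Hi))
      + (sqrt (real (card {e \<in> E. e \<subseteq> V2}) / 108) / 2 - 8 / \<epsilon>) \<le> out"
    using expec_alg_ge_balanced expec_side1_ge_half[OF G complement_partition eps] by argo
  show "9 / 10 * real (card E) - (real (card E) - real (card {e \<in> E. e \<subseteq> V1})) / 2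
      - 12 / \<epsilon> * real (card {v \<in> V1. 1 \<le> degree E v}) - 8 / \<epsilon> \<le> out"
    using expec_alg_ge_side1 expec_side1_ge_cut[OF G complement_partition eps T(1)] T(2) by linarith
qed (use assms eps expec_alg_ge_crossing expec_alg_ge_half in auto)

end

section \<open>Laplace noise\<close>

lemma laplace_density_measurable [measurable]: "laplace_density b \<in> borel_measurable borel"
  unfolding laplace_density_def[abs_def] by measurable

lemma sets_laplace [measurable_cong, simp]: "sets (laplace b) = sets borel"
  and space_laplace [simp]: "space (laplace b) = UNIV"
  by (simp_all add: laplace_def)

lemma laplace_density_uminus: "laplace_density b (- x) = laplace_density b x"
  by (simp add: laplace_density_def)

lemma nn_integral_laplace_ge:
  assumes "b > 0" "t \<ge> 0"
  shows "(\<integral>\<^sup>+x. ennreal (laplace_density b x) * indicator {t..} x \<partial>lborel) = ennreal (exp (- t / b) / 2)"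
proof -
  have "(\<integral>\<^sup>+x. ennreal (laplace_density b x) * indicator {t..} x \<partial>lborel)
      = (\<integral>\<^sup>+x. ennreal (exp (- x / b) / (2 * b)) * indicator {t..} x \<partial>lborel)"
    using assms by (intro nn_integral_cong) (auto simp: laplace_density_def indicator_def)
  also have "\<dots> = ennreal (0 - (- exp (- t / b) / 2))"
  proof (rule nn_integral_FTC_atLeast)
    show "((\<lambda>x. - exp (- x / b) / 2) \<longlongrightarrow> 0) at_top"
      using assms by real_asymp
    show "((\<lambda>x. - exp (- x / b) / 2) has_real_derivative exp (- x / b) / (2 * b)) (at x)" for x
      using assms by (auto intro!: derivative_eq_intros)
  qed (use assms in auto)
  finally show ?thesis by simp
qed

lemma nn_integral_laplace_le:
  assumes "b > 0" "t \<ge> 0"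
  shows "(\<integral>\<^sup>+x. ennreal (laplace_density b x) * indicator {..-t} x \<partial>lborel) = ennreal (exp (- t / b) / 2)"
proof -
  have "(\<integral>\<^sup>+x. ennreal (laplace_density b x) * indicator {..-t} x \<partial>lborel)
      = (\<integral>\<^sup>+x. ennreal (laplace_density b (- x)) * indicator {..-t} (- x) \<partial>lborel)"
    by (subst nn_integral_real_affine[where c = "-1" and t = 0]) auto
  also have "\<dots> = (\<integral>\<^sup>+x. ennreal (laplace_density b x) * indicator {t..} x \<partial>lborel)"
    by (intro nn_integral_cong) (auto simp: laplace_density_uminus indicator_def)
  finally show ?thesis using nn_integral_laplace_ge[OF assms] by simp
qed

lemma prob_space_laplace:
  assumes "b > 0"
  shows "prob_space (laplace b)"
proof
  let ?f = "\<lambda>x. ennreal (laplace_density b x)"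
  have "emeasure (laplace b) (space (laplace b)) = (\<integral>\<^sup>+x. ?f x \<partial>lborel)"
    by (simp add: laplace_def emeasure_density)
  \<comment> \<open>The two half-lines overlap only in \<open>0\<close>, a null set.\<close>
  also have "\<dots> = (\<integral>\<^sup>+x. ?f x * indicator {0..} x + ?f x * indicator {..-0} x \<partial>lborel)"
    by (intro nn_integral_cong_AE eventually_mono[OF AE_lborel_singleton[of 0]]) (auto simp: indicator_def)
  also have "\<dots> = ennreal (1 / 2) + ennreal (1 / 2)"
    using nn_integral_laplace_ge[OF assms, of 0] nn_integral_laplace_le[OF assms, of 0]
    by (subst nn_integral_add) auto
  also have "\<dots> = ennreal (1 / 2 + 1 / 2)" by (rule ennreal_plus[symmetric]) auto
  also have "\<dots> = 1" by simp
  finally show "emeasure (laplace b) (space (laplace b)) = 1" .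
qed

text \<open>The strict and the weak inequality match membership and non-membership in
  \<open>V1_of\<close>.\<close>

lemma laplace_tails:
  assumes "b > 0" "t \<ge> 0"
  shows "measure (laplace b) {x. t < x} \<le> exp (- t / b) / 2"
    and "measure (laplace b) {x. x \<le> - t} \<le> exp (- t / b) / 2"
proof -
  interpret prob_space "laplace b" by (rule prob_space_laplace[OF assms(1)])
  have "emeasure (laplace b) {t..} = ennreal (exp (- t / b) / 2)"
    using nn_integral_laplace_ge[OF assms] by (simp add: laplace_def emeasure_density)
  moreover have "emeasure (laplace b) {..-t} = ennreal (exp (- t / b) / 2)"
    using nn_integral_laplace_le[OF assms] by (simp add: laplace_def emeasure_density)
  ultimately have "prob {t..} = exp (- t / b) / 2" "prob {..-t} = exp (- t / b) / 2"
    by (simp_all add: measure_def)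
  moreover have "prob {x. t < x} \<le> prob {t..}" by (intro finite_measure_mono) auto
  moreover have "{x. x \<le> - t} = {..-t}" by auto
  ultimately show "prob {x. t < x} \<le> exp (- t / b) / 2" "prob {x. x \<le> - t} \<le> exp (- t / b) / 2"
    by simp_all
qed

section \<open>The vertex partition as a random variable\<close>

abbreviation noise :: "real \<Rightarrow> nat \<Rightarrow> (nat \<Rightarrow> real) measure" where
  "noise \<epsilon> n \<equiv> PiM {..<n} (\<lambda>_. laplace (12 / \<epsilon>))"

context
  fixes n :: nat and E :: "nat set set" and \<epsilon> \<alpha> :: real
  assumes eps: "\<epsilon> > 0"
begin

lemma prob_space_noise: "prob_space (noise \<epsilon> n)"
  using eps by (intro prob_space_PiM prob_space_laplace) auto

text \<open>\<open>V1_of\<close> has finitely many values, so single fibres suffice, and each is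
  given by finitely many threshold conditions on coordinates. Everything computed from
  \<open>V1\<close> then becomes measurable by composition.\<close>

lemma measurable_V1: "V1_of \<epsilon> \<alpha> n E \<in> measurable (noise \<epsilon> n) (count_space (Pow {..<n}))"
proof (subst measurable_count_space_eq2; (intro conjI ballI)?)
  show "V1_of \<epsilon> \<alpha> n E \<in> space (noise \<epsilon> n) \<rightarrow> Pow {..<n}" by (auto simp: V1_of_def)
  fix A assume A: "A \<in> Pow {..<n}"
  have eq: "{v \<in> B. P v} = A \<longleftrightarrow> (\<forall>v\<in>B. P v = (v \<in> A))" if "A \<subseteq> B" for B P
    using that by blast
  have "V1_of \<epsilon> \<alpha> n E -` {A} \<inter> space (noise \<epsilon> n)
      = {x \<in> space (noise \<epsilon> n). \<forall>v\<in>{..<n}. (real (degree E v) + x v > 24 / \<epsilon> powr (1 + \<alpha>)) = (v \<in> A)}"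
    using A unfolding V1_of_def vimage_def by (subst eq[symmetric]) auto
  also have "\<dots> \<in> sets (noise \<epsilon> n)"
  proof (rule sets.sets_Collect_finite_All)
    fix v assume "v \<in> {..<n}"
    then have [measurable]: "(\<lambda>x. x v) \<in> borel_measurable (noise \<epsilon> n)"
      using measurable_component_singleton[of v "{..<n}" "\<lambda>_. laplace (12 / \<epsilon>)"] by simp
    show "{x \<in> space (noise \<epsilon> n). (real (degree E v) + x v > 24 / \<epsilon> powr (1 + \<alpha>)) = (v \<in> A)} \<in> sets (noise \<epsilon> n)"
      by measurable
  qed simp
  finally show "V1_of \<epsilon> \<alpha> n E -` {A} \<inter> space (noise \<epsilon> n) \<in> sets (noise \<epsilon> n)" .
qed auto

lemma measurable_V1_compose: "(\<And>W. W \<subseteq> {..<n} \<Longrightarrow> g W \<in> space N) \<Longrightarrow> (\<lambda>x. g (V1_of \<epsilon> \<alpha> n E x)) \<in> measurable (noise \<epsilon> n) N"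
  by (rule measurable_compose[OF measurable_V1]) auto

lemma integrable_V1_compose:
  fixes g :: "nat set \<Rightarrow> real"
  shows "integrable (noise \<epsilon> n) (\<lambda>x. g (V1_of \<epsilon> \<alpha> n E x))"
proof -
  interpret prob_space "noise \<epsilon> n" by (rule prob_space_noise)
  have "\<bar>g (V1_of \<epsilon> \<alpha> n E x)\<bar> \<le> (\<Sum>W\<in>Pow {..<n}. \<bar>g W\<bar>)" for x
    by (rule member_le_sum[where f = "\<lambda>W. \<bar>g W\<bar>"]) (auto simp: V1_of_def)
  then show ?thesis
    by (intro integrable_const_bound[where B = "\<Sum>W\<in>Pow {..<n}. \<bar>g W\<bar>"] measurable_V1_compose) auto
qed

text \<open>\<open>val\<close> is bounded by \<open>card E\<close>, which justifies integrating in
  stages: first the discrete draws, then the noise.\<close>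

lemma integral_alg:
  assumes fE: "finite E"
  shows "(\<integral>S. real (val E S) \<partial>(alg \<epsilon> \<alpha> n E))
    = (\<integral>x. expec (alg_given_V1 \<epsilon> \<alpha> n E (V1_of \<epsilon> \<alpha> n E x)) (\<lambda>S. real (val E S)) \<partial>noise \<epsilon> n)"
  unfolding alg_def
proof (rule integral_bind[where K = "count_space UNIV" and B = "real (card E)" and B' = 1])
  interpret prob_space "noise \<epsilon> n" by (rule prob_space_noise)
  show "finite_measure (noise \<epsilon> n)" by unfold_locales
  show "\<bar>real (val E S)\<bar> \<le> real (card E)" for S
    unfolding val_def using fE by (auto intro: card_mono)
  show "(\<lambda>x. measure_pmf (alg_given_V1 \<epsilon> \<alpha> n E (V1_of \<epsilon> \<alpha> n E x))) \<in> measurable (noise \<epsilon> n) (subprob_algebra (count_space UNIV))"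
    by (rule measurable_V1_compose) (rule measure_pmf_in_subprob_algebra)
qed (auto simp: measure_pmf.emeasure_space_1)

lemma prob_noise_component:
  assumes "v < n" "A \<in> sets borel"
  shows "measure (noise \<epsilon> n) {x \<in> space (noise \<epsilon> n). x v \<in> A} = measure (laplace (12 / \<epsilon>)) A"
proof -
  have "measure (laplace (12 / \<epsilon>)) A = measure (distr (noise \<epsilon> n) (laplace (12 / \<epsilon>)) (\<lambda>x. x v)) A"
    using assms eps by (subst distr_PiM_component) (auto intro: prob_space_laplace)
  also have "\<dots> = measure (noise \<epsilon> n) ((\<lambda>x. x v) -` A \<inter> space (noise \<epsilon> n))"
    using assms by (intro measure_distr) auto
  also have "(\<lambda>x. x v) -` A \<inter> space (noise \<epsilon> n) = {x \<in> space (noise \<epsilon> n). x v \<in> A}" by auto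
  finally show ?thesis by simp
qed

lemma expectation_mem_V1:
  assumes "v < n"
  shows "(\<integral>x. of_bool (v \<in> V1_of \<epsilon> \<alpha> n E x) \<partial>noise \<epsilon> n)
    = measure (laplace (12 / \<epsilon>)) {y. 24 / \<epsilon> powr (1 + \<alpha>) - real (degree E v) < y}"
    and "(\<integral>x. of_bool (v \<notin> V1_of \<epsilon> \<alpha> n E x) \<partial>noise \<epsilon> n)
    = measure (laplace (12 / \<epsilon>)) {y. y \<le> 24 / \<epsilon> powr (1 + \<alpha>) - real (degree E v)}"
proof -
  let ?t = "24 / \<epsilon> powr (1 + \<alpha>) - real (degree E v)"
  have *: "(\<integral>x. of_bool (x v \<in> A) \<partial>noise \<epsilon> n) = measure (laplace (12 / \<epsilon>)) A" if "A \<in> sets borel" for A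
  proof -
    have "(\<integral>x. of_bool (x v \<in> A) \<partial>noise \<epsilon> n) = (\<integral>x. (indicator {x \<in> space (noise \<epsilon> n). x v \<in> A} x :: real) \<partial>noise \<epsilon> n)"
      by (intro Bochner_Integration.integral_cong) (auto simp: indicator_def)
    then show ?thesis using prob_noise_component[OF assms that] by (simp add: Int_absorb2 Collect_restrict)
  qed
  have "(\<integral>x. of_bool (v \<in> V1_of \<epsilon> \<alpha> n E x) \<partial>noise \<epsilon> n) = (\<integral>x. (of_bool (x v \<in> {y. ?t < y}) :: real) \<partial>noise \<epsilon> n)"
    using assms by (intro Bochner_Integration.integral_cong) (auto simp: V1_of_def)
  also have "\<dots> = measure (laplace (12 / \<epsilon>)) {y. ?t < y}" by (rule *) simp
  finally show "(\<integral>x. of_bool (v \<in> V1_of \<epsilon> \<alpha> n E x) \<partial>noise \<epsilon> n) = measure (laplace (12 / \<epsilon>)) {y. ?t < y}" .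
  have "(\<integral>x. of_bool (v \<notin> V1_of \<epsilon> \<alpha> n E x) \<partial>noise \<epsilon> n) = (\<integral>x. (of_bool (x v \<in> {y. y \<le> ?t}) :: real) \<partial>noise \<epsilon> n)"
    using assms by (intro Bochner_Integration.integral_cong) (auto simp: V1_of_def)
  also have "\<dots> = measure (laplace (12 / \<epsilon>)) {y. y \<le> ?t}" by (rule *) simp
  finally show "(\<integral>x. of_bool (v \<notin> V1_of \<epsilon> \<alpha> n E x) \<partial>noise \<epsilon> n) = measure (laplace (12 / \<epsilon>)) {y. y \<le> ?t}" .
qed

end

section \<open>The expected cut\<close>

lemma exp_minus_le: "0 \<le> x \<Longrightarrow> exp (- x) \<le> 1 / (1 + x)" for x :: real
  using exp_ge_add_one_self[of x] by (simp add: exp_minus field_simps)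

context
  fixes n :: nat and E :: "nat set set" and \<epsilon> \<alpha> p q :: real
  assumes G: "simple_graph n E" and eps: "0 < \<epsilon>" "\<epsilon> \<le> 0.1"
    and small: "\<epsilon> powr \<alpha> \<le> min 0.0106 (1.8 / ln (10 / \<epsilon> powr (1 + \<alpha>)))"
  defines "p \<equiv> \<epsilon> powr (1 + \<alpha>)" and "q \<equiv> \<epsilon> powr \<alpha>"
begin

lemma pq: "0 < p" "0 < q" "p = \<epsilon> * q" "q \<le> 106 / 10000" "p \<le> 1" "ln (10 / p) \<le> 1.8 / q"
proof -
  show pos: "0 < p" "0 < q" using eps by (auto simp: p_def q_def)
  show pq: "p = \<epsilon> * q" using eps by (simp add: p_def q_def powr_add)
  show q: "q \<le> 106 / 10000" using small by (simp add: q_def)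
  have "\<epsilon> * q \<le> 1 * 1" using eps q pos by (intro mult_mono) auto
  then show p1: "p \<le> 1" using pq by simp
  \<comment> \<open>Positivity of the logarithm allows the hypothesis on \<open>q\<close> to be
    cross-multiplied.\<close>
  have "1 < 10 / p" using p1 pos by (simp add: field_simps)
  then have "0 < ln (10 / p)" by (rule ln_gt_zero)
  moreover have "q \<le> 1.8 / ln (10 / p)" using small by (simp add: q_def p_def)
  ultimately show "ln (10 / p) \<le> 1.8 / q" using pos by (simp add: field_simps)
qed

text \<open>A bound linear in the degree, so that summing degrees yields a multiple of
  \<open>card E\<close>. Isolated vertices also enter \<open>V1\<close> with positive probability
  and would violate it, hence the conjunct on the degree.\<close>

lemma expectation_mem_V1_le:
  assumes v: "v < n"
  shows "(\<integral>x. of_bool (v \<in> V1_of \<epsilon> \<alpha> n E x \<and> 1 \<le> degree E v) \<partial>noise \<epsilon> n) \<le> p / 20 * real (degree E v)"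
proof (cases "1 \<le> degree E v")
  case True
  let ?d = "real (degree E v)" and ?b = "12 / \<epsilon>"
  let ?P = "measure (laplace ?b) {y. 24 / p - ?d < y}"
  have b: "?b > 0" using eps by simp
  have tail: "?P \<le> exp (- x) / 2" if "24 / p - ?d \<ge> x * ?b" "x \<ge> 0" for x
  proof -
    have "x * ?b \<ge> 0" using that(2) b by simp
    then have t0: "24 / p - ?d \<ge> 0" using that(1) by linarith
    have "x \<le> (24 / p - ?d) / ?b" using that(1) b by (subst pos_le_divide_eq) auto
    then show ?thesis using laplace_tails(1)[OF b t0] by (smt (verit) divide_right_mono exp_le_cancel_iff minus_divide_left)
  qed
  have scale: "x / q * ?b = 12 * x / p" for x using eps pq(1,2) by (simp add: pq(3) mult.commute)
  have "?P \<le> p / 20 * ?d"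
  proof -
    \<comment> \<open>From \<open>21.6 / p\<close> on the claimed bound exceeds 1. In the middle
      range it is at least \<open>0.12\<close>, and a margin of \<open>0.2 / q\<close> noise scales
      suffices. Below, the degree may be 1 and the target \<open>p / 20\<close>, which the margin
      \<open>1.8 / q\<close> meets by the logarithmic hypothesis.\<close>
    consider "?d \<ge> 216 / 10 / p" | "24 / 10 / p \<le> ?d" "?d \<le> 216 / 10 / p" | "?d \<le> 24 / 10 / p" by linarith
    then show ?thesis
    proof cases
      case 1
      interpret prob_space "laplace ?b" by (rule prob_space_laplace[OF b])
      have "1 \<le> p / 20 * ?d" using 1 pq(1) by (simp add: field_simps)
      then show ?thesis using prob_le_1[of "{y. 24 / p - ?d < y}"] by linarith
    next
      case 2
      have "(2 / 10 / q) * ?b = 24 / p - 216 / 10 / p" unfolding scale by (simp add: field_simps)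
      also have "\<dots> \<le> 24 / p - ?d" using 2(2) by (rule diff_left_mono)
      finally have "24 / p - ?d \<ge> (2 / 10 / q) * ?b" .
      then have "?P \<le> exp (- (2 / 10 / q)) / 2" using pq(2) by (intro tail) auto
      also have "\<dots> \<le> 1 / (1 + 2 / 10 / q) / 2"
        by (rule divide_right_mono[OF exp_minus_le]) (use pq(2) in auto)
      also have "\<dots> \<le> 12 / 100" using pq(2,4) by (simp add: field_simps)
      also have "\<dots> \<le> p / 20 * ?d" using 2(1) pq(1) by (simp add: field_simps)
      finally show ?thesis .
    next
      case 3
      have "(1.8 / q) * ?b = 24 / p - 24 / 10 / p" unfolding scale by (simp add: field_simps)
      also have "\<dots> \<le> 24 / p - ?d" using 3 by (rule diff_left_mono)
      finally have "24 / p - ?d \<ge> (1.8 / q) * ?b" .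
      then have "?P \<le> exp (- (1.8 / q)) / 2" using pq(2) by (intro tail) auto
      also have "\<dots> \<le> exp (- ln (10 / p)) / 2" using pq(6) by simp
      also have "\<dots> = p / 20 * 1" using pq(1) by (simp add: exp_minus)
      also have "\<dots> \<le> p / 20 * ?d" using True pq(1) by (intro mult_left_mono) auto
      finally show ?thesis .
    qed
  qed
  then show ?thesis using True expectation_mem_V1(1)[OF eps(1) v, where E = E and \<alpha> = \<alpha>] by (simp add: p_def)
qed (use pq(1) in simp)

text \<open>The degree exceeds the threshold by \<open>30 / p - 24 / p = 6 / p\<close>, which is
  \<open>1 / (2 * q)\<close> noise scales; for \<open>q \<le> 0.0106\<close> even the crude
  \<open>exp_minus_le\<close> is enough.\<close>

lemma expectation_not_mem_V1_le:
  assumes v: "v < n" and high: "30 / p < real (degree E v)"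
  shows "(\<integral>x. of_bool (v \<notin> V1_of \<epsilon> \<alpha> n E x) \<partial>noise \<epsilon> n) \<le> (11 / 1000 :: real)"
proof -
  let ?b = "12 / \<epsilon>"
  have b: "?b > 0" using eps by simp
  interpret prob_space "laplace ?b" by (rule prob_space_laplace[OF b])
  have "(\<integral>x. of_bool (v \<notin> V1_of \<epsilon> \<alpha> n E x) \<partial>noise \<epsilon> n) = prob {y. y \<le> 24 / p - real (degree E v)}"
    using expectation_mem_V1(2)[OF eps(1) v, where E = E and \<alpha> = \<alpha>] by (simp add: p_def)
  also have "\<dots> \<le> prob {y. y \<le> - (6 / p)}" using high by (intro finite_measure_mono) auto
  also have "\<dots> \<le> exp (- (6 / p) / ?b) / 2" using pq(1) by (intro laplace_tails(2) b) auto
  also have "- (6 / p) / ?b = - (1 / 2 / q)" using eps pq(1,2) by (simp add: pq(3))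
  also have "exp (- (1 / 2 / q)) / 2 \<le> 1 / (1 + 1 / 2 / q) / 2"
    by (rule divide_right_mono[OF exp_minus_le]) (use pq(2) in auto)
  also have "\<dots> \<le> 11 / 1000" using pq(2,4) by (simp add: field_simps)
  finally show ?thesis .
qed

lemma expectation_card_V1:
  "(\<integral>x. real (card {v \<in> V1_of \<epsilon> \<alpha> n E x. 1 \<le> degree E v}) \<partial>noise \<epsilon> n) \<le> p * real (card E) / 10"
proof -
  have "real (card {v \<in> V1_of \<epsilon> \<alpha> n E x. 1 \<le> degree E v}) = (\<Sum>v<n. of_bool (v \<in> V1_of \<epsilon> \<alpha> n E x \<and> 1 \<le> degree E v))" for x
  proof -
    have "{v \<in> V1_of \<epsilon> \<alpha> n E x. 1 \<le> degree E v} = {..<n} \<inter> {v. v \<in> V1_of \<epsilon> \<alpha> n E x \<and> 1 \<le> degree E v}" by (auto simp: V1_of_def)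
    then show ?thesis by (simp add: of_bool_def sum.If_cases)
  qed
  then have "(\<integral>x. real (card {v \<in> V1_of \<epsilon> \<alpha> n E x. 1 \<le> degree E v}) \<partial>noise \<epsilon> n)
      = (\<integral>x. (\<Sum>v<n. of_bool (v \<in> V1_of \<epsilon> \<alpha> n E x \<and> 1 \<le> degree E v)) \<partial>noise \<epsilon> n)" by simp
  also have "\<dots> = (\<Sum>v<n. (\<integral>x. of_bool (v \<in> V1_of \<epsilon> \<alpha> n E x \<and> 1 \<le> degree E v) \<partial>noise \<epsilon> n))"
    by (intro Bochner_Integration.integral_sum integrable_V1_compose[OF eps(1), where g = "\<lambda>W. of_bool (v \<in> W \<and> P v)" for v P])
  also have "\<dots> \<le> (\<Sum>v<n. p / 20 * real (degree E v))" by (intro sum_mono expectation_mem_V1_le) simp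
  also have "\<dots> = p / 20 * (\<Sum>v<n. real (degree E v))" by (rule sum_distrib_left[symmetric])
  also have "\<dots> = p * real (card E) / 10" by (simp add: sum_degrees[OF G])
  finally show ?thesis .
qed

text \<open>Such an edge needs a high-degree endpoint that the noise pushed below the threshold; one
  endpoint decides the bound for each edge.\<close>

lemma expectation_card_high:
  "(\<integral>x. real (card {e \<in> E. e \<subseteq> {..<n} - V1_of \<epsilon> \<alpha> n E x \<and> (\<exists>u\<in>e. 30 / p < real (degree E u))}) \<partial>noise \<epsilon> n)
    \<le> 11 / 1000 * real (card E)"
proof -
  let ?P = "\<lambda>e W. e \<subseteq> {..<n} - W \<and> (\<exists>u\<in>e. 30 / p < real (degree E u))"
  have fE: "finite E" by (rule finite_simple_graph[OF G])
  have "real (card {e \<in> E. ?P e (V1_of \<epsilon> \<alpha> n E x)}) = (\<Sum>e\<in>E. of_bool (?P e (V1_of \<epsilon> \<alpha> n E x)))" for x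
    using fE by (simp add: of_bool_def sum.If_cases Int_def)
  then have "(\<integral>x. real (card {e \<in> E. ?P e (V1_of \<epsilon> \<alpha> n E x)}) \<partial>noise \<epsilon> n) = (\<integral>x. (\<Sum>e\<in>E. of_bool (?P e (V1_of \<epsilon> \<alpha> n E x))) \<partial>noise \<epsilon> n)" by simp
  also have "\<dots> = (\<Sum>e\<in>E. (\<integral>x. of_bool (?P e (V1_of \<epsilon> \<alpha> n E x)) \<partial>noise \<epsilon> n))"
    by (intro Bochner_Integration.integral_sum integrable_V1_compose[OF eps(1), where g = "\<lambda>W. of_bool (?P e W)" for e])
  also have "\<dots> \<le> (\<Sum>e\<in>E. 11 / 1000)"
  proof (intro sum_mono)
    fix e assume e: "e \<in> E"
    show "(\<integral>x. of_bool (?P e (V1_of \<epsilon> \<alpha> n E x)) \<partial>noise \<epsilon> n) \<le> (11 / 1000 :: real)"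
    proof (cases "\<exists>u\<in>e. 30 / p < real (degree E u)")
      case True
      then obtain u where u: "u \<in> e" "30 / p < real (degree E u)" by blast
      have "u < n" using e u G by (auto elim: simple_graph_edgeE)
      have "(\<integral>x. of_bool (?P e (V1_of \<epsilon> \<alpha> n E x)) \<partial>noise \<epsilon> n) \<le> (\<integral>x. (of_bool (u \<notin> V1_of \<epsilon> \<alpha> n E x) :: real) \<partial>noise \<epsilon> n)"
        using u by (intro integral_mono integrable_V1_compose[OF eps(1), where g = "\<lambda>W. of_bool (?P e W)"]
          integrable_V1_compose[OF eps(1), where g = "\<lambda>W. of_bool (u \<notin> W)"]) auto
      also have "\<dots> \<le> 11 / 1000" by (rule expectation_not_mem_V1_le[OF \<open>u < n\<close> u(2)])
      finally show ?thesis .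
    qed simp
  qed
  finally show ?thesis by simp
qed

lemma expectation_alg_ge_half:
  "real (card E) / 2 - 8 / \<epsilon> \<le> (\<integral>S. real (val E S) \<partial>(alg \<epsilon> \<alpha> n E))"
proof -
  interpret prob_space "noise \<epsilon> n" by (rule prob_space_noise[OF eps(1)])
  have "(\<integral>x. real (card E) / 2 - 8 / \<epsilon> \<partial>noise \<epsilon> n)
      \<le> (\<integral>x. expec (alg_given_V1 \<epsilon> \<alpha> n E (V1_of \<epsilon> \<alpha> n E x)) (\<lambda>S. real (val E S)) \<partial>noise \<epsilon> n)"
    by (intro integral_mono integrable_const expec_alg_ge_half[OF G _ eps(1)]
        integrable_V1_compose[OF eps(1), where g = "\<lambda>W. expec (alg_given_V1 \<epsilon> \<alpha> n E W) (\<lambda>S. real (val E S))"])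
       (auto simp: V1_of_def)
  then show ?thesis unfolding integral_alg[OF eps(1) finite_simple_graph[OF G]] by (simp add: prob_space)
qed

lemma expectation_alg_ge:
  assumes m: "real (card E) * \<epsilon>\<^sup>2 \<ge> 1000000000"
    and T: "T \<in> cuts {..<n}" "9 / 10 * real (card E) \<le> real (val E T)"
  shows "(1 / 2 + p / 1000000) * real (card E) \<le> (\<integral>S. real (val E S) \<partial>(alg \<epsilon> \<alpha> n E))"
proof -
  interpret prob_space "noise \<epsilon> n" by (rule prob_space_noise[OF eps(1)])
  define N where "N = (\<lambda>W. real (card {v \<in> W. 1 \<le> degree E v}))"
  define H where "H = (\<lambda>W. real (card {e \<in> E. e \<subseteq> {..<n} - W \<and> (\<exists>u\<in>e. 30 / p < real (degree E u))}))"
  define M where "M = real (card E)"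
  define g where "g = p / 9800"
  define B where "B = (8 / \<epsilon> + g * (9 / 100 * M)) * (240 / (\<epsilon> * M))"
  have "0 < M * \<epsilon>\<^sup>2" using m by (simp add: M_def)
  then have M: "M > 0" using eps by (auto simp: zero_less_mult_iff)
  have g: "g > 0" using pq by (simp add: g_def)
  have B: "B \<ge> 0" using M g eps by (simp add: B_def)
  note intN = integrable_V1_compose[OF eps(1), where g = N, of n \<alpha> E]
  note intH = integrable_V1_compose[OF eps(1), where g = H, of n \<alpha> E]
  have EN: "(\<integral>x. N (V1_of \<epsilon> \<alpha> n E x) \<partial>noise \<epsilon> n) \<le> p * M / 10" using expectation_card_V1 by (simp add: N_def M_def)
  have EH: "(\<integral>x. H (V1_of \<epsilon> \<alpha> n E x) \<partial>noise \<epsilon> n) \<le> 11 / 1000 * M" using expectation_card_high by (simp add: H_def M_def)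
  \<comment> \<open>The selection loss contributes \<open>192 * p / \<epsilon>\<^sup>2\<close>.
    Keeping it below \<open>g * M * (2 / 1000)\<close> needs \<open>M * \<epsilon>\<^sup>2\<close>
    of about \<open>192 * 9800 * 500\<close>, just under \<open>1000000000\<close>, the tightest use
    of that constant. The rest is \<open>2.16 * q\<close> times \<open>g * M\<close>, small by
    \<open>q \<le> 0.0106\<close>.\<close>
  have BN: "B * (p * M / 10) \<le> g * M * (3 / 100)"
  proof -
    have "192 * p / \<epsilon>\<^sup>2 \<le> 192 * p * (M / 1000000000)"
    proof -
      have "1 / \<epsilon>\<^sup>2 \<le> M / 1000000000" using m eps by (simp add: M_def field_simps)
      then have "(192 * p) * (1 / \<epsilon>\<^sup>2) \<le> (192 * p) * (M / 1000000000)" using pq by (intro mult_left_mono) auto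
      then show ?thesis by simp
    qed
    also have "\<dots> \<le> g * M * (2 / 1000)" using pq M by (simp add: g_def)
    finally have 1: "192 * p / \<epsilon>\<^sup>2 \<le> g * M * (2 / 1000)" .
    have "B * (p * M / 10) = 192 * p / \<epsilon>\<^sup>2 + g * M * (216 / 100) * q"
      using M eps by (simp add: B_def pq(3) field_simps power2_eq_square)
    also have "g * M * (216 / 100) * q \<le> g * M * (216 / 100) * (106 / 10000)"
      using g M pq(4) by (intro mult_left_mono) auto
    finally have "B * (p * M / 10) \<le> 192 * p / \<epsilon>\<^sup>2 + g * M * (216 / 100) * (106 / 10000)" by simp
    moreover have "0 < g * M" using g M by simp
    ultimately show ?thesis using 1 by linarith
  qed
  \<comment> \<open>What remains of the gain is \<open>0.09 - 0.011 - 0.03 = 0.049\<close> times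
    \<open>p / 9800 * M\<close>, about \<open>5 * p * M / 1000000\<close>.\<close>
  have "(1 / 2 + p / 1000000) * M \<le> M / 2 + g * (9 / 100 * M) - g * (11 / 1000 * M) - g * M * (3 / 100)"
    using pq M by (simp add: g_def field_simps)
  also have "\<dots> \<le> M / 2 + g * (9 / 100 * M) - g * (\<integral>x. H (V1_of \<epsilon> \<alpha> n E x) \<partial>noise \<epsilon> n) - B * (\<integral>x. N (V1_of \<epsilon> \<alpha> n E x) \<partial>noise \<epsilon> n)"
    using mult_left_mono[OF EH, of g] mult_left_mono[OF EN B] BN g by linarith
  also have "\<dots> = (\<integral>x. M / 2 + g * (9 / 100 * M) - g * H (V1_of \<epsilon> \<alpha> n E x) - B * N (V1_of \<epsilon> \<alpha> n E x) \<partial>noise \<epsilon> n)"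
    using intN intH by (simp add: prob_space)
  also have "\<dots> \<le> (\<integral>x. expec (alg_given_V1 \<epsilon> \<alpha> n E (V1_of \<epsilon> \<alpha> n E x)) (\<lambda>S. real (val E S)) \<partial>noise \<epsilon> n)"
  proof (intro integral_mono)
    fix x
    have "V1_of \<epsilon> \<alpha> n E x \<subseteq> {..<n}" by (auto simp: V1_of_def)
    then have "M / 2 + g * (9 / 100 * M - H (V1_of \<epsilon> \<alpha> n E x)) - (8 / \<epsilon> + g * (9 / 100 * M)) * (240 * N (V1_of \<epsilon> \<alpha> n E x) / (\<epsilon> * M))
        \<le> expec (alg_given_V1 \<epsilon> \<alpha> n E (V1_of \<epsilon> \<alpha> n E x)) (\<lambda>S. real (val E S))"
      unfolding M_def g_def N_def H_def p_def
      using eps pq(5) by (intro expec_alg_ge[OF G _ eps(1) _ _ m T]) (auto simp: p_def)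
    moreover have "(8 / \<epsilon> + g * (9 / 100 * M)) * (240 * N (V1_of \<epsilon> \<alpha> n E x) / (\<epsilon> * M)) = B * N (V1_of \<epsilon> \<alpha> n E x)"
      by (simp add: B_def)
    ultimately show "M / 2 + g * (9 / 100 * M) - g * H (V1_of \<epsilon> \<alpha> n E x) - B * N (V1_of \<epsilon> \<alpha> n E x)
        \<le> expec (alg_given_V1 \<epsilon> \<alpha> n E (V1_of \<epsilon> \<alpha> n E x)) (\<lambda>S. real (val E S))"
      by (simp add: right_diff_distrib)
  qed (use intN intH integrable_V1_compose[OF eps(1), where g = "\<lambda>W. expec (alg_given_V1 \<epsilon> \<alpha> n E W) (\<lambda>S. real (val E S))"] in auto)
  also have "\<dots> = (\<integral>S. real (val E S) \<partial>(alg \<epsilon> \<alpha> n E))"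
    by (rule integral_alg[OF eps(1) finite_simple_graph[OF G], symmetric])
  finally show ?thesis by (simp add: M_def)
qed

lemma expectation_alg_ge_OPT:
  assumes m: "real (card E) * \<epsilon>\<^sup>2 \<ge> 1000000000"
  shows "(1 / 2 + p / 1000000) * real (OPT n E) \<le> (\<integral>S. real (val E S) \<partial>(alg \<epsilon> \<alpha> n E))"
proof -
  have "OPT n E \<in> val E ` cuts {..<n}"
    unfolding OPT_def by (intro Max_in) (auto simp: finite_cuts cuts_nonempty)
  then obtain T where T: "T \<in> cuts {..<n}" "OPT n E = val E T" by auto
  have le: "OPT n E \<le> card E"
    unfolding T(2) val_def using finite_simple_graph[OF G] by (intro card_mono) auto
  show ?thesis
  proof (cases "9 / 10 * real (card E) \<le> real (OPT n E)")
    case True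
    have "(1 / 2 + p / 1000000) * real (OPT n E) \<le> (1 / 2 + p / 1000000) * real (card E)"
      using le pq by (intro mult_left_mono) auto
    also have "\<dots> \<le> (\<integral>S. real (val E S) \<partial>(alg \<epsilon> \<alpha> n E))"
      using True T by (intro expectation_alg_ge[OF m T(1)]) auto
    finally show ?thesis .
  next
    case False
    \<comment> \<open>The target is at most \<open>0.51 * 0.9 = 0.459\<close> times the number of
      edges, and a loss of one percent from one half stays above it.\<close>
    have "(1 / 2 + p / 1000000) * real (OPT n E) \<le> (51 / 100) * (9 / 10 * real (card E))"
      using False pq by (intro mult_mono) auto
    also have "\<dots> \<le> real (card E) / 2 - 8 / \<epsilon>"
    proof -
      have "\<epsilon>\<^sup>2 \<le> \<epsilon>" using eps by (simp add: power2_eq_square mult_left_le)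
      then have "real (card E) * \<epsilon>\<^sup>2 \<le> real (card E) * \<epsilon>" by (intro mult_left_mono) auto
      then have "1000000000 \<le> real (card E) * \<epsilon>" using m by linarith
      then have "8 / \<epsilon> \<le> real (card E) / 100" using eps by (simp add: field_simps)
      then show ?thesis by simp
    qed
    also have "\<dots> \<le> (\<integral>S. real (val E S) \<partial>(alg \<epsilon> \<alpha> n E))" by (rule expectation_alg_ge_half)
    finally show ?thesis .
  qed
qed

end

theorem theorem5p8:
  shows "\<exists>C > 0. \<exists>c > (0::real). \<forall>(\<alpha>::real) (\<epsilon>::real) (n::nat) (E::nat set set).
     \<alpha> > 0 \<longrightarrow> 0 \<le> \<epsilon> \<longrightarrow> \<epsilon> \<le> 0.1 \<longrightarrow>
     \<epsilon> powr \<alpha> \<le> min 0.0106 (1.8 / ln (10 / \<epsilon> powr (1 + \<alpha>))) \<longrightarrow>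
     simple_graph n E \<longrightarrow>
     real (card E) * \<epsilon>\<^sup>2 \<ge> C \<longrightarrow>
     (\<integral>S. real (val E S) \<partial>(alg \<epsilon> \<alpha> n E)) \<ge> (1/2 + c * \<epsilon> powr (1 + \<alpha>)) * real (OPT n E)"
proof (rule exI[of _ 1000000000], intro conjI, simp, rule exI[of _ "1 / 1000000"], intro conjI allI impI, simp)
  fix \<alpha> \<epsilon> :: real and n :: nat and E :: "nat set set"
  assume "0 \<le> \<epsilon>" and le: "\<epsilon> \<le> 0.1"
    and small: "\<epsilon> powr \<alpha> \<le> min 0.0106 (1.8 / ln (10 / \<epsilon> powr (1 + \<alpha>)))"
    and G: "simple_graph n E" and m: "1000000000 \<le> real (card E) * \<epsilon>\<^sup>2"
  \<comment> \<open>For \<open>\<epsilon> = 0\<close> the size condition would read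
    \<open>1000000000 \<le> 0\<close>.\<close>
  have "\<epsilon> \<noteq> 0" using m by auto
  then have "0 < \<epsilon>" using \<open>0 \<le> \<epsilon>\<close> by simp
  from expectation_alg_ge_OPT[OF G this le small m]
  show "(1/2 + 1 / 1000000 * \<epsilon> powr (1 + \<alpha>)) * real (OPT n E) \<le> (\<integral>S. real (val E S) \<partial>(alg \<epsilon> \<alpha> n E))"
    by simp
qed

end
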